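(* Let $\mathscr C_\infty=[\mathcal X/\langle\alpha\rangle]$ be the archimedean equivariant topos over $\mathbf F_{1^2}$, i.e. the quotient by the involution $\alpha$ of the absolute projective line $\mathcal X=(\mathbb P^1_{\mathbf F_{1^2}},\mathcal O)$ enriched by an imaginary generator, and let $\mathscr C_\infty(\mathbf C)$ be its set of complex points, i.e. the set of $\alpha$-orbits in $\mathcal X(\mathbf C)$. Then: (1) The set $\mathscr C_\infty(\mathbf C)$ is in canonical bijection with the classical projective line $\mathbb P^1(\mathbf C)=\mathbf C\cup\{\infty\}$. (2) Under this canonical bijection, the canonical action of complex conjugation $c\in\mathrm{Gal}(\mathbf C/\mathbf R)$ on $\mathscr C_\infty(\mathbf C)$ (induced by $\phi\mapsto c\circ\phi$ on $\mathcal X(\mathbf C)$) induces the fixed-point-free involution $$z\longmapsto-\frac1{\bar z}$$ of $\mathbb P^1(\mathbf C)$ (which exchanges $0$ and $\infty$).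
   Context: **Spherical algebras.** $\mathbf F_1$-algebras are monoids in the category of $\Gamma$-sets (functors from finite pointed sets to pointed sets) for the Day convolution (Lydakis) product. For a commutative pointed monoid $M$ (with absorbing element $0$ and unit $1$), $\mathbf F_1[M]$ denotes the spherical algebra $X\mapsto M\wedge X$. For a commutative ring $R$, $HR$ denotes its Eilenberg–MacLane $\mathbf F_1$-algebra, with $HR(1_+)=R$. Homomorphisms $\mathbf F_1[M]\to HR$ are the same as maps $M\to R$ that are multiplicative and preserve $0$ and $1$. Let $\mathbf F_{1^2}:=\mathbf F_1[\{0,1,\epsilon:\epsilon^2=1\}]$. Each $HR$ is an $\mathbf F_{1^2}$-algebra via $\epsilon\mapsto-1_R$, so homomorphisms of $\mathbf F_{1^2}$-algebras to $HR$ must send $\epsilon$ to $-1_R$. **The space $\mathcal X$.** Its underlying space has two closed points $+,-$ and a generic point $\eta$, with nontrivial open sets $\Omega_+=\{+,\eta\}$, $\Omega_-=\{-,\eta\}$, $\Omega=\Omega_+\cap\Omega_-=\{\eta\}$. The structure sheaf $\mathcal O$ of spherical $\mathbf F_{1^2}$-algebras is $$\mathcal O(\Omega_+)=\mathbf F_{1^2}[T^{\mathbf Z_{\ge0}},J_+]/(J_+^2=\epsilon),\quad \mathcal O(\Omega_-)=\mathbf F_{1^2}[T^{\mathbf Z_{\le0}},J_-]/(J_-^2=\epsilon),\quad \mathcal O(\Omega)=\mathbf F_{1^2}[T^{\mathbf Z},J]/(J^2=\epsilon),$$ i.e. the spherical algebras of the commutative pointed monoids $\{0\}\cup\{\epsilon^aT^kJ_\bullet^b: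 a,b\in\{0,1\}\}$ with $k\ge0$, $k\le 0$, $k\in\mathbf Z$ respectively. The restriction maps $\rho_\pm:\mathcal O(\Omega_\pm)\to\mathcal O(\Omega)$ are the canonical inclusions on powers of $T$, together with $J_+\mapsto J$ and $J_-\mapsto\epsilon J$. **Points.** For a field $K$, $\mathcal X(K)$ is the colimit of the sets $\mathrm{Hom}_{\mathbf F_{1^2}}(\mathcal O(U),HK)$ over $U\in\{\Omega_+,\Omega_-,\Omega\}$; that is, $\mathrm{Hom}(\mathcal O(\Omega_+),HK)$ and $\mathrm{Hom}(\mathcal O(\Omega_-),HK)$ are glued along $\mathrm{Hom}(\mathcal O(\Omega),HK)$ via $\phi\mapsto\phi\circ\rho_\pm$. **The involution $\alpha$.** $\alpha:\mathcal X\to\mathcal X$ exchanges $+$ and $-$, fixes $\eta$, and acts on the sheaf by the $\mathbf F_{1^2}$-algebra maps $\alpha^*:\mathcal O(\Omega)\to\mathcal O(\Omega)$, $\alpha^*(T)=\epsilon T^{-1}$, $\alpha^*(J)=J^{-1}=\epsilon J$; $\alpha_+^*:\mathcal O(\Omega_-)\to\mathcal O(\Omega_+)$, $\alpha_+^*(T^{-1})=\epsilon T$, $\alpha_+^*(J_-)=J_+$; $\alpha_-^*:\mathcal O(\Omega_+)\to\mathcal O(\Omega_-)$, $\alpha_-^*(T)=\epsilon T^{-1}$, $\alpha_-^*(J_+)=J_-$. It acts on points by $\alpha\cdot\phi=\phi\circ\alpha^*$ (with the appropriate version of $\alpha^*$), and $\mathscr C_\infty(K)=\mathcal X(K)/\langle\alpha\rangle$.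 **The canonical bijection.** It is the map $\mathbb P^1(\mathbf C)\to\mathscr C_\infty(\mathbf C)$ sending $z\in\mathbf C$ to the $\alpha$-orbit of the point $\phi\in\mathrm{Hom}(\mathcal O(\Omega_+),H\mathbf C)$ with $\phi(T)=z$, $\phi(J_+)=i$, and sending $\infty$ to the $\alpha$-orbit of the point $\phi\in\mathrm{Hom}(\mathcal O(\Omega_-),H\mathbf C)$ with $\phi(T^{-1})=0$, $\phi(J_-)=-i$. *)

theory Defs
  imports
    "HOL-Analysis.Analysis"
    "HOL-Algebra.Group"
    "HOL-Combinatorics.Orbits"
begin

section \<open>Finite pointed sets\<close>

text \<open>
  We use the skeleton with objects \<open>n\<^sub>+ = {0..n}\<close>, pointed by \<open>0\<close>.  Morphisms are extensional
  functions, so that equality of morphisms is equality of HOL functions.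
\<close>

definition pmaps :: "nat \<Rightarrow> nat \<Rightarrow> (nat \<Rightarrow> nat) set" where
  "pmaps n m = {f \<in> {0..n} \<rightarrow>\<^sub>E {0..m}. f 0 = 0}"

text \<open>
  The smash product \<open>n\<^sub>+ \<and> m\<^sub>+\<close> is identified with \<open>(n * m)\<^sub>+\<close> by ordering the pairs of
  non-base points lexicographically: \<open>smash m i j\<close> is the index of \<open>i \<and> j\<close>, where \<open>m\<close> is the
  size of the second factor.  With this choice the skeleton is strictly monoidal.
\<close>

definition smash :: "nat \<Rightarrow> nat \<Rightarrow> nat \<Rightarrow> nat" where
  "smash m i j = (if i = 0 \<or> j = 0 then 0 else (i - 1) * m + j)"

definition smash_fst :: "nat \<Rightarrow> nat \<Rightarrow> nat" where
  "smash_fst m k = (if k = 0 then 0 else (k - 1) div m + 1)"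

definition smash_snd :: "nat \<Rightarrow> nat \<Rightarrow> nat" where
  "smash_snd m k = (if k = 0 then 0 else (k - 1) mod m + 1)"

definition smash_map ::
    "nat \<Rightarrow> nat \<Rightarrow> nat \<Rightarrow> (nat \<Rightarrow> nat) \<Rightarrow> (nat \<Rightarrow> nat) \<Rightarrow> nat \<Rightarrow> nat" where
  "smash_map n m m' f g =
     (\<lambda>k\<in>{0..n * m}. smash m' (f (smash_fst m k)) (g (smash_snd m k)))"

section \<open>\<open>\<Gamma>\<close>-sets and \<open>\<^bold>F\<^sub>1\<close>-algebras\<close>

record 'a gamma_set =
  car :: "nat \<Rightarrow> 'a set"
  base :: "nat \<Rightarrow> 'a"
  act :: "nat \<Rightarrow> nat \<Rightarrow> (nat \<Rightarrow> nat) \<Rightarrow> 'a \<Rightarrow> 'a"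

locale gamma_set =
  fixes A (structure)
  assumes base_in: "base A n \<in> car A n"
    and car_0: "car A 0 = {base A 0}"
    and act_in: "f \<in> pmaps n m \<Longrightarrow> a \<in> car A n \<Longrightarrow> act A n m f a \<in> car A m"
    and act_base: "f \<in> pmaps n m \<Longrightarrow> act A n m f (base A n) = base A m"
    and act_id: "a \<in> car A n \<Longrightarrow> act A n n (\<lambda>i\<in>{0..n}. i) a = a"
    and act_compose: "f \<in> pmaps n m \<Longrightarrow> g \<in> pmaps m l \<Longrightarrow> a \<in> car A n \<Longrightarrow>
      act A n l (compose {0..n} g f) a = act A m l g (act A n m f a)"

text \<open>
  By the universal property of the Day convolution product, a monoid structure on a
  \<open>\<Gamma>\<close>-set \<open>A\<close> amounts to natural pointed maps
  \<open>A(n\<^sub>+) \<and> A(m\<^sub>+) \<rightarrow> A(n\<^sub>+ \<and> m\<^sub>+)\<close> and a map from the unit object \<open>n\<^sub>+ \<mapsto> n\<^sub>+\<close>,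
  subject to the associativity and unit laws.
\<close>

record 'a F1alg = "'a gamma_set" +
  unt :: "nat \<Rightarrow> nat \<Rightarrow> 'a"
  prd :: "nat \<Rightarrow> nat \<Rightarrow> 'a \<Rightarrow> 'a \<Rightarrow> 'a"

locale F1_algebra = gamma_set +
  assumes unt_in: "i \<le> n \<Longrightarrow> unt A n i \<in> car A n"
    and unt_base: "unt A n 0 = base A n"
    and unt_nat: "f \<in> pmaps n m \<Longrightarrow> i \<le> n \<Longrightarrow> act A n m f (unt A n i) = unt A m (f i)"
    and prd_in: "a \<in> car A n \<Longrightarrow> b \<in> car A m \<Longrightarrow> prd A n m a b \<in> car A (n * m)"
    and prd_base_left: "b \<in> car A m \<Longrightarrow> prd A n m (base A n) b = base A (n * m)"
    and prd_base_right: "a \<in> car A n \<Longrightarrow> prd A n m a (base A m) = base A (n * m)"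
    and prd_nat: "f \<in> pmaps n n' \<Longrightarrow> g \<in> pmaps m m' \<Longrightarrow> a \<in> car A n \<Longrightarrow> b \<in> car A m \<Longrightarrow>
      act A (n * m) (n' * m') (smash_map n m m' f g) (prd A n m a b)
        = prd A n' m' (act A n n' f a) (act A m m' g b)"
    and prd_assoc: "a \<in> car A n \<Longrightarrow> b \<in> car A m \<Longrightarrow> c \<in> car A l \<Longrightarrow>
      prd A (n * m) l (prd A n m a b) c = prd A n (m * l) a (prd A m l b c)"
    and prd_unt_left: "a \<in> car A n \<Longrightarrow> prd A 1 n (unt A 1 1) a = a"
    and prd_unt_right: "a \<in> car A n \<Longrightarrow> prd A n 1 a (unt A 1 1) = a"

definition F1_hom ::
    "('a, 'x) F1alg_scheme \<Rightarrow> ('b, 'y) F1alg_scheme \<Rightarrow> (nat \<Rightarrow> 'a \<Rightarrow> 'b) set" where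
  "F1_hom A B = {h.
     (\<forall>n. h n \<in> car A n \<rightarrow>\<^sub>E car B n) \<and>
     (\<forall>n. h n (base A n) = base B n) \<and>
     (\<forall>n m. \<forall>f\<in>pmaps n m. \<forall>a\<in>car A n. h m (act A n m f a) = act B n m f (h n a)) \<and>
     (\<forall>n. \<forall>i\<le>n. h n (unt A n i) = unt B n i) \<and>
     (\<forall>n m. \<forall>a\<in>car A n. \<forall>b\<in>car A m.
        h (n * m) (prd A n m a b) = prd B n m (h n a) (h m b))}"

definition F1_comp ::
    "('a, 'x) F1alg_scheme \<Rightarrow> (nat \<Rightarrow> 'b \<Rightarrow> 'c) \<Rightarrow> (nat \<Rightarrow> 'a \<Rightarrow> 'b) \<Rightarrow> nat \<Rightarrow> 'a \<Rightarrow> 'c" where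
  "F1_comp A h g = (\<lambda>n. compose (car A n) (h n) (g n))"

section \<open>Spherical algebras and Eilenberg--MacLane algebras\<close>

record 'm pmonoid = "'m monoid" +
  absorb :: 'm

locale comm_pmonoid = comm_monoid M for M :: "('m, 'x) pmonoid_scheme" (structure) +
  assumes absorb_in: "absorb M \<in> carrier M"
    and absorb_mult: "x \<in> carrier M \<Longrightarrow> absorb M \<otimes> x = absorb M"

definition pmonoid_hom ::
    "('m, 'x) pmonoid_scheme \<Rightarrow> ('n, 'y) pmonoid_scheme \<Rightarrow> ('m \<Rightarrow> 'n) set" where
  "pmonoid_hom M N = {g \<in> hom M N. g \<one>\<^bsub>M\<^esub> = \<one>\<^bsub>N\<^esub> \<and> g (absorb M) = absorb N}"

text \<open>\<open>wedge M x j\<close> is the class of \<open>(x, j)\<close> in \<open>M \<and> n\<^sub>+\<close>, the base point being \<open>(0, 0)\<close>.\<close>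

definition wedge :: "('m, 'x) pmonoid_scheme \<Rightarrow> 'm \<Rightarrow> nat \<Rightarrow> 'm \<times> nat" where
  "wedge M x j = (if x = absorb M \<or> j = 0 then (absorb M, 0) else (x, j))"

definition spherical :: "('m, 'x) pmonoid_scheme \<Rightarrow> ('m \<times> nat) F1alg" where
  "spherical M =
    \<lparr> car = (\<lambda>n. {wedge M x j | x j. x \<in> carrier M \<and> j \<le> n}),
      base = (\<lambda>n. (absorb M, 0)),
      act = (\<lambda>n m f p. wedge M (fst p) (f (snd p))),
      unt = (\<lambda>n i. wedge M \<one>\<^bsub>M\<^esub> i),
      prd = (\<lambda>n m p q. wedge M (fst p \<otimes>\<^bsub>M\<^esub> fst q) (smash m (snd p) (snd q))) \<rparr>"

definition spherical_map ::
    "('m, 'x) pmonoid_scheme \<Rightarrow> ('n, 'y) pmonoid_scheme \<Rightarrow> ('m \<Rightarrow> 'n)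
      \<Rightarrow> nat \<Rightarrow> 'm \<times> nat \<Rightarrow> 'n \<times> nat" where
  "spherical_map M N g = (\<lambda>n. \<lambda>p\<in>car (spherical M) n. wedge N (g (fst p)) (snd p))"

text \<open>
  \<open>HR(n\<^sub>+)\<close> consists of the \<open>R\<close>-valued functions on \<open>n\<^sub>+\<close> vanishing at the base point, here
  extended by zero to all of \<open>nat\<close>; a pointed map acts by summation over its fibres.
\<close>

definition HR :: "(nat \<Rightarrow> 'r::comm_ring_1) F1alg" where
  "HR =
    \<lparr> car = (\<lambda>n. {u. \<forall>k. k \<notin> {1..n} \<longrightarrow> u k = 0}),
      base = (\<lambda>n k. 0),
      act = (\<lambda>n m f u k. if k \<in> {1..m} then (\<Sum>i\<in>{i\<in>{1..n}. f i = k}. u i) else 0),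
      unt = (\<lambda>n i k. if k = i \<and> i \<in> {1..n} then 1 else 0),
      prd = (\<lambda>n m u v k. if k \<in> {1..n * m} then u (smash_fst m k) * v (smash_snd m k) else 0) \<rparr>"

definition HR_map :: "('r::comm_ring_1 \<Rightarrow> 's::comm_ring_1) \<Rightarrow> nat \<Rightarrow> (nat \<Rightarrow> 'r) \<Rightarrow> nat \<Rightarrow> 's" where
  "HR_map c = (\<lambda>n. \<lambda>u\<in>car HR n. (\<lambda>k. c (u k)))"

text \<open>
  The homomorphism \<open>\<^bold>F\<^sub>1[M] \<rightarrow> HR\<close> attached to a map \<open>f : M \<rightarrow> R\<close>; conversely \<open>ev h x\<close>
  is the value at \<open>x \<in> M\<close> of the underlying map \<open>M = \<^bold>F\<^sub>1[M](1\<^sub>+) \<rightarrow> HR(1\<^sub>+) = R\<close>.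
\<close>

definition to_HR ::
    "('m, 'x) pmonoid_scheme \<Rightarrow> ('m \<Rightarrow> 'r::comm_ring_1) \<Rightarrow> nat \<Rightarrow> 'm \<times> nat \<Rightarrow> nat \<Rightarrow> 'r" where
  "to_HR M f = (\<lambda>n. \<lambda>p\<in>car (spherical M) n.
     (\<lambda>k. if k = snd p \<and> snd p \<noteq> 0 then f (fst p) else 0))"

definition ev :: "('m, 'x) pmonoid_scheme \<Rightarrow> (nat \<Rightarrow> 'm \<times> nat \<Rightarrow> nat \<Rightarrow> 'r) \<Rightarrow> 'm \<Rightarrow> 'r" where
  "ev M h x = h 1 (wedge M x 1) 1"

definition mult_map :: "('m, 'x) pmonoid_scheme \<Rightarrow> ('m \<Rightarrow> 'r::comm_ring_1) \<Rightarrow> bool" where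
  "mult_map M f \<longleftrightarrow> f (absorb M) = 0 \<and> f \<one>\<^bsub>M\<^esub> = 1 \<and>
    (\<forall>x\<in>carrier M. \<forall>y\<in>carrier M. f (x \<otimes>\<^bsub>M\<^esub> y) = f x * f y)"

section \<open>The pointed monoids in \<open>\<epsilon>\<close>, \<open>T\<close> and \<open>J\<close>\<close>

text \<open>
  \<open>Mon a k b\<close> stands for \<open>\<epsilon>\<^sup>a T\<^sup>k J\<^sup>b\<close>, where \<open>J\<close> is to be read as \<open>J\<^sub>+\<close>, \<open>J\<^sub>-\<close> or \<open>J\<close>
  according to the open set on which the monomial lives.
\<close>

datatype tj = Zero | Mon (eps_exp: bool) (deg: int) (J_exp: bool)

fun tj_mult :: "tj \<Rightarrow> tj \<Rightarrow> tj" where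
  "tj_mult (Mon a k b) (Mon a' k' b') = Mon (a \<noteq> (a' \<noteq> (b \<and> b'))) (k + k') (b \<noteq> b')"
| "tj_mult _ _ = Zero"

abbreviation "tj_one \<equiv> Mon False 0 False"
abbreviation "tj_eps \<equiv> Mon True 0 False"
abbreviation "tj_T k \<equiv> Mon False k False"
abbreviation "tj_J \<equiv> Mon False 0 True"

definition tj_monoid :: "tj set \<Rightarrow> tj pmonoid" where
  "tj_monoid S = \<lparr> carrier = S, mult = tj_mult, one = tj_one, absorb = Zero \<rparr>"

section \<open>Algebras over \<open>\<^bold>F\<^bsub>1\<^sup>2\<^esub> = \<^bold>F\<^sub>1[{0, 1, \<epsilon> : \<epsilon>\<^sup>2 = 1}]\<close>\<close>

definition eps_monoid :: "tj pmonoid" where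
  "eps_monoid = tj_monoid {Zero, tj_one, tj_eps}"

definition F12 :: "(tj \<times> nat) F1alg" where
  "F12 = spherical eps_monoid"

text \<open>An \<open>\<^bold>F\<^sub>1\<close>-algebra together with its structure morphism from \<open>F12\<close>.\<close>

type_synonym 'a F12alg = "'a F1alg \<times> (nat \<Rightarrow> tj \<times> nat \<Rightarrow> 'a)"

definition F12_hom :: "'a F12alg \<Rightarrow> 'b F12alg \<Rightarrow> (nat \<Rightarrow> 'a \<Rightarrow> 'b) set" where
  "F12_hom A B = {h \<in> F1_hom (fst A) (fst B). F1_comp F12 h (snd A) = snd B}"

fun eps_sign :: "tj \<Rightarrow> 'r::comm_ring_1" where
  "eps_sign Zero = 0"
| "eps_sign (Mon a k b) = (if a then - 1 else 1)"

definition HR12 :: "(nat \<Rightarrow> 'r::comm_ring_1) F12alg" where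
  "HR12 = (HR, to_HR eps_monoid eps_sign)"

section \<open>The space \<open>\<X>\<close>\<close>

datatype xpt = Plus | Minus | Eta

definition Omega_plus :: "xpt set" where "Omega_plus = {Plus, Eta}"
definition Omega_minus :: "xpt set" where "Omega_minus = {Minus, Eta}"
definition Omega :: "xpt set" where "Omega = Omega_plus \<inter> Omega_minus"

definition X_top :: "xpt topology" where
  "X_top = topology (\<lambda>U. U \<in> {{}, Omega, Omega_plus, Omega_minus, UNIV})"

text \<open>The nontrivial open sets; they form a base, on which the structure sheaf is given below.\<close>

definition X_opens :: "xpt set set" where
  "X_opens = {U. openin X_top U \<and> U \<noteq> {} \<and> U \<noteq> topspace X_top}"

definition O_mon :: "xpt set \<Rightarrow> tj pmonoid" where
  "O_mon U = tj_monoid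
     (insert Zero {Mon a k b | a k b. (Plus \<in> U \<longrightarrow> k \<ge> 0) \<and> (Minus \<in> U \<longrightarrow> k \<le> 0)})"

definition O_X :: "xpt set \<Rightarrow> (tj \<times> nat) F12alg" where
  "O_X U = (spherical (O_mon U), spherical_map eps_monoid (O_mon U) id)"

text \<open>For \<open>V \<subseteq> U\<close> in \<open>X_opens\<close>, the only restriction not sending \<open>J\<close> to \<open>J\<close> is \<open>J\<^sub>- \<mapsto> \<epsilon> J\<close>.\<close>

fun rho_mon :: "xpt set \<Rightarrow> xpt set \<Rightarrow> tj \<Rightarrow> tj" where
  "rho_mon U V Zero = Zero"
| "rho_mon U V (Mon a k b) = Mon (a \<noteq> (b \<and> Minus \<in> U \<and> Minus \<notin> V)) k b"

definition rho :: "xpt set \<Rightarrow> xpt set \<Rightarrow> nat \<Rightarrow> tj \<times> nat \<Rightarrow> tj \<times> nat" where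
  "rho U V = spherical_map (O_mon U) (O_mon V) (rho_mon U V)"

section \<open>Points of \<open>\<X>\<close> over a field\<close>

type_synonym 'k pre_point = "xpt set \<times> (nat \<Rightarrow> tj \<times> nat \<Rightarrow> nat \<Rightarrow> 'k)"

definition pre_points :: "'k::field pre_point set" where
  "pre_points = (SIGMA U:X_opens. F12_hom (O_X U) HR12)"

definition glue :: "'k::field pre_point rel" where
  "glue = {((V, h), (U, F1_comp (fst (O_X U)) h (rho U V))) | U V h.
     U \<in> X_opens \<and> V \<in> X_opens \<and> V \<subseteq> U \<and> h \<in> F12_hom (O_X V) HR12}"

definition X_rel :: "'k::field pre_point rel" where
  "X_rel = (glue \<union> glue\<inverse>)\<^sup>*"

text \<open>The colimit of the sets \<open>Hom(O(U), HK)\<close> as a quotient of their disjoint union.\<close>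

definition X_points :: "'k::field pre_point set set" where
  "X_points = pre_points // X_rel"

definition X_class :: "'k::field pre_point \<Rightarrow> 'k pre_point set" where
  "X_class p = X_rel `` {p}"

section \<open>The involution \<open>\<alpha>\<close>\<close>

fun alpha_pt :: "xpt \<Rightarrow> xpt" where
  "alpha_pt Plus = Minus"
| "alpha_pt Minus = Plus"
| "alpha_pt Eta = Eta"

text \<open>
  The map \<open>O(U) \<rightarrow> O(\<alpha>\<^sup>-\<^sup>1 U)\<close>, multiplicatively extended from \<open>T \<mapsto> \<epsilon> T\<^sup>-\<^sup>1\<close> together with
  \<open>J \<mapsto> J\<^sup>-\<^sup>1 = \<epsilon> J\<close> over \<open>Omega\<close> and \<open>J\<^sub>\<plusminus> \<mapsto> J\<^sub>\<minusplus>\<close> over the two charts.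
\<close>

fun alpha_mon :: "xpt set \<Rightarrow> tj \<Rightarrow> tj" where
  "alpha_mon U Zero = Zero"
| "alpha_mon U (Mon a k b) = Mon (a \<noteq> (odd k \<noteq> (b \<and> U = Omega))) (- k) b"

definition alpha_star :: "xpt set \<Rightarrow> nat \<Rightarrow> tj \<times> nat \<Rightarrow> tj \<times> nat" where
  "alpha_star U = spherical_map (O_mon U) (O_mon (alpha_pt -` U)) (alpha_mon U)"

definition alpha_pre :: "'k::field pre_point \<Rightarrow> 'k pre_point" where
  "alpha_pre p = (let V = alpha_pt ` fst p in
     (V, F1_comp (fst (O_X V)) (snd p) (alpha_star V)))"

text \<open>
  Maps between quotients are given as images of equivalence classes.  Here this is again a class,
  because \<open>alpha_pre\<close> is an involution of \<open>pre_points\<close> compatible with \<open>glue\<close>; see the lemmas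
  \<open>alpha_pre_involutive\<close> and \<open>alpha_pre_glue\<close>.
\<close>

definition alpha_X :: "'k::field pre_point set \<Rightarrow> 'k pre_point set" where
  "alpha_X P = alpha_pre ` P"

text \<open>As \<open>\<alpha>\<close> has order two, its forward orbits are the orbits of the group it generates.\<close>

definition C_infty :: "'k::field pre_point set set set" where
  "C_infty = orbit alpha_X ` X_points"

section \<open>Galois action, projective line and the canonical map\<close>

definition gal_pre :: "('k::field \<Rightarrow> 'k) \<Rightarrow> 'k pre_point \<Rightarrow> 'k pre_point" where
  "gal_pre c p = (fst p, F1_comp (fst (O_X (fst p))) (HR_map c) (snd p))"

definition gal_X :: "('k::field \<Rightarrow> 'k) \<Rightarrow> 'k pre_point set \<Rightarrow> 'k pre_point set" where
  "gal_X c P = gal_pre c ` P"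

definition gal_C_infty ::
    "('k::field \<Rightarrow> 'k) \<Rightarrow> 'k pre_point set set \<Rightarrow> 'k pre_point set set" where
  "gal_C_infty c Q = gal_X c ` Q"

datatype 'k P1 = Fin 'k | Infty

fun canon :: "complex P1 \<Rightarrow> complex pre_point set set" where
  "canon (Fin z) = orbit alpha_X (X_class (Omega_plus,
     THE h. h \<in> F12_hom (O_X Omega_plus) HR12 \<and>
       ev (O_mon Omega_plus) h (tj_T 1) = z \<and> ev (O_mon Omega_plus) h tj_J = \<i>))"
| "canon Infty = orbit alpha_X (X_class (Omega_minus,
     THE h. h \<in> F12_hom (O_X Omega_minus) HR12 \<and>
       ev (O_mon Omega_minus) h (tj_T (- 1)) = 0 \<and> ev (O_mon Omega_minus) h tj_J = - \<i>))"

fun antipode :: "complex P1 \<Rightarrow> complex P1" where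
  "antipode (Fin z) = (if z = 0 then Infty else Fin (- 1 / cnj z))"
| "antipode Infty = Fin 0"

section \<open>Well-definedness of the data above\<close>

lemma all_xpt: "(\<forall>x. P x) \<longleftrightarrow> P Plus \<and> P Minus \<and> P Eta"
  by (metis xpt.exhaust)

lemma X_top_iff:
  "U \<in> {{}, Omega, Omega_plus, Omega_minus, UNIV} \<longleftrightarrow> (Plus \<in> U \<or> Minus \<in> U \<longrightarrow> Eta \<in> U)"
  unfolding Omega_def Omega_plus_def Omega_minus_def set_eq_iff all_xpt
    insert_iff empty_iff UNIV_I Int_iff
  by (cases "Plus \<in> U"; cases "Minus \<in> U"; cases "Eta \<in> U"; simp add: set_eq_iff all_xpt)

lemma openin_X_top: "openin X_top U \<longleftrightarrow> U \<in> {{}, Omega, Omega_plus, Omega_minus, UNIV}"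
proof -
  have "istopology (\<lambda>U. Plus \<in> U \<or> Minus \<in> U \<longrightarrow> Eta \<in> U)"
    by (auto simp only: istopology_def Int_iff Union_iff)
  from topology_inverse'[OF this] show ?thesis
    unfolding X_top_def X_top_iff by (rule fun_cong)
qed

lemma X_opens_eq: "X_opens = {Omega_plus, Omega_minus, Omega}"
proof -
  have "openin X_top UNIV" unfolding openin_X_top by (simp only: insert_iff simp_thms)
  then have t: "topspace X_top = UNIV"
    by (intro top.extremum_uniqueI openin_subset)
  have d: "{} \<noteq> Omega_plus" "{} \<noteq> Omega_minus" "{} \<noteq> Omega"
    "UNIV \<noteq> Omega_plus" "UNIV \<noteq> Omega_minus" "UNIV \<noteq> Omega"
    by (simp_all add: Omega_def Omega_plus_def Omega_minus_def set_eq_iff all_xpt)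
  show ?thesis
    unfolding X_opens_def openin_X_top t using d by fast
qed

lemma comm_pmonoid_tj_monoid:
  assumes "Zero \<in> S" "tj_one \<in> S" "\<And>x y. x \<in> S \<Longrightarrow> y \<in> S \<Longrightarrow> tj_mult x y \<in> S"
  shows "comm_pmonoid (tj_monoid S)"
proof unfold_locales
  fix x y z
  show "x \<otimes>\<^bsub>tj_monoid S\<^esub> y \<otimes>\<^bsub>tj_monoid S\<^esub> z = x \<otimes>\<^bsub>tj_monoid S\<^esub> (y \<otimes>\<^bsub>tj_monoid S\<^esub> z)"
    by (cases x; cases y; cases z) (auto simp: tj_monoid_def)
  show "x \<otimes>\<^bsub>tj_monoid S\<^esub> y = y \<otimes>\<^bsub>tj_monoid S\<^esub> x"
    by (cases x; cases y) (auto simp: tj_monoid_def)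
  show "\<one>\<^bsub>tj_monoid S\<^esub> \<otimes>\<^bsub>tj_monoid S\<^esub> x = x" "x \<otimes>\<^bsub>tj_monoid S\<^esub> \<one>\<^bsub>tj_monoid S\<^esub> = x"
    by (cases x; auto simp: tj_monoid_def)+
qed (use assms in \<open>auto simp: tj_monoid_def\<close>)

lemma comm_pmonoid_eps_monoid: "comm_pmonoid eps_monoid"
  unfolding eps_monoid_def by (rule comm_pmonoid_tj_monoid) auto

lemma comm_pmonoid_O_mon: "comm_pmonoid (O_mon U)"
  unfolding O_mon_def by (rule comm_pmonoid_tj_monoid) auto

subsection \<open>Spherical and Eilenberg--MacLane algebras are \<open>\<^bold>F\<^sub>1\<close>-algebras\<close>

lemma smash_le: "i \<le> n \<Longrightarrow> j \<le> m \<Longrightarrow> smash m i j \<le> n * m"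
proof -
  assume a: "i \<le> n" "j \<le> m"
  { assume "i \<noteq> 0" "j \<noteq> 0"
    have "(i - 1) * m + j \<le> (i - 1) * m + m" using a by simp
    also have "\<dots> = i * m" using \<open>i \<noteq> 0\<close> by (cases i) auto
    also have "\<dots> \<le> n * m" using a by simp
    finally have ?thesis by (simp add: smash_def) }
  then show ?thesis by (auto simp: smash_def)
qed

lemma smash_eq_0: "smash m i j = 0 \<longleftrightarrow> i = 0 \<or> j = 0"
  by (auto simp: smash_def)

lemma smash_fst_smash: "0 < i \<Longrightarrow> 0 < j \<Longrightarrow> j \<le> m \<Longrightarrow> smash_fst m (smash m i j) = i"
proof -
  assume a: "0 < i" "0 < j" "j \<le> m"
  obtain j' where "j = Suc j'" using a by (cases j) auto
  then show ?thesis using a by (simp add: smash_fst_def smash_def)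
qed

lemma smash_snd_smash: "0 < i \<Longrightarrow> 0 < j \<Longrightarrow> j \<le> m \<Longrightarrow> smash_snd m (smash m i j) = j"
proof -
  assume a: "0 < i" "0 < j" "j \<le> m"
  obtain j' where "j = Suc j'" using a by (cases j) auto
  then show ?thesis using a by (simp add: smash_snd_def smash_def)
qed

lemma smash_cases:
  assumes "k \<in> {1..n * m}"
  obtains i j where "i \<in> {1..n}" "j \<in> {1..m}" "k = smash m i j"
proof
  from assms have m: "m > 0" by (cases m) auto
  show "(k - 1) div m + 1 \<in> {1..n}" using assms m
    by (auto simp: Suc_le_eq less_mult_imp_div_less)
  show "(k - 1) mod m + 1 \<in> {1..m}" using m by (simp add: Suc_le_eq)
  show "k = smash m ((k - 1) div m + 1) ((k - 1) mod m + 1)"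
    using assms by (simp add: smash_def)
qed

lemma smash_assoc: "k \<le> l \<Longrightarrow> j \<le> m \<Longrightarrow> smash l (smash m i j) k = smash (m * l) i (smash l j k)"
  by (cases i; cases j; cases k) (auto simp: smash_def algebra_simps)

lemma smash_map_smash: "f \<in> pmaps n n' \<Longrightarrow> g \<in> pmaps m m' \<Longrightarrow> i \<le> n \<Longrightarrow> j \<le> m \<Longrightarrow>
  smash_map n m m' f g (smash m i j) = smash m' (f i) (g j)"
  apply (cases "i = 0 \<or> j = 0")
   apply (auto simp: smash_map_def smash_eq_0 smash_le smash_fst_smash smash_snd_smash pmaps_def)
   apply (auto simp: smash_def smash_fst_def smash_snd_def)
  done

lemma pmaps_le: "f \<in> pmaps n m \<Longrightarrow> i \<le> n \<Longrightarrow> f i \<le> m"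
  and pmaps_0: "f \<in> pmaps n m \<Longrightarrow> f 0 = 0"
  by (auto simp: pmaps_def PiE_def Pi_def)

lemma wedge_in_spherical: "x \<in> carrier M \<Longrightarrow> j \<le> n \<Longrightarrow> wedge M x j \<in> car (spherical M) n"
  by (auto simp: spherical_def)

lemma spherical_carE:
  assumes "a \<in> car (spherical M) n"
  obtains x j where "a = wedge M x j" "x \<in> carrier M" "j \<le> n"
  using assms by (auto simp: spherical_def)

lemma smash_inj:
  assumes "smash m i j = smash m i' j'" "0 < i" "0 < j" "j \<le> m" "0 < i'" "0 < j'" "j' \<le> m"
  shows "i = i'" "j = j'"
  using assms smash_fst_smash smash_snd_smash by metis+

lemma pmaps_compose: "f \<in> pmaps n m \<Longrightarrow> g \<in> pmaps m l \<Longrightarrow> compose {0..n} g f \<in> pmaps n l"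
  by (auto simp: pmaps_def compose_def PiE_def Pi_def)

lemma smash_fst_le: "k \<le> n * m \<Longrightarrow> smash_fst m k \<le> n"
  and smash_snd_le: "k \<le> n * m \<Longrightarrow> smash_snd m k \<le> m"
proof -
  assume k: "k \<le> n * m"
  have "smash_fst m k \<le> n \<and> smash_snd m k \<le> m"
  proof (cases "k = 0")
    case False
    then have "k \<in> {1..n * m}" using k by auto
    then show ?thesis by (rule smash_cases) (auto simp: smash_fst_smash smash_snd_smash)
  qed (simp add: smash_fst_def smash_snd_def)
  then show "smash_fst m k \<le> n" "smash_snd m k \<le> m" by auto
qed

lemma smash_map_in_pmaps:
  assumes "f \<in> pmaps n n'" "g \<in> pmaps m m'"
  shows "smash_map n m m' f g \<in> pmaps (n * m) (n' * m')"
proof -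
  have "smash m' (f (smash_fst m k)) (g (smash_snd m k)) \<le> n' * m'" if "k \<le> n * m" for k
    using smash_le[OF pmaps_le[OF assms(1) smash_fst_le[OF that]]
      pmaps_le[OF assms(2) smash_snd_le[OF that]]] .
  then show ?thesis using pmaps_0[OF assms(1)]
    by (auto simp: pmaps_def smash_map_def) (auto simp: smash_def smash_fst_def)
qed

lemma (in comm_pmonoid) mult_absorb [simp]:
  "x \<in> carrier M \<Longrightarrow> absorb M \<otimes> x = absorb M"
  "x \<in> carrier M \<Longrightarrow> x \<otimes> absorb M = absorb M"
  using absorb_mult m_comm absorb_in by auto

lemma (in comm_pmonoid) spherical_simps:
  "base (spherical M) n = wedge M (absorb M) 0"
  "i \<le> n \<Longrightarrow> unt (spherical M) n i = wedge M \<one> i"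
  "f \<in> pmaps n m \<Longrightarrow> act (spherical M) n m f (wedge M x i) = wedge M x (f i)"
  "x \<in> carrier M \<Longrightarrow> y \<in> carrier M \<Longrightarrow> prd (spherical M) n m (wedge M x i) (wedge M y j) 
     = wedge M (x \<otimes> y) (smash m i j)"
  by (auto simp: spherical_def wedge_def pmaps_0 smash_eq_0 absorb_in)

lemma (in comm_pmonoid) spherical_F1_algebra: "F1_algebra (spherical M)"
proof (unfold_locales, goal_cases)
  case 1 show ?case by (simp add: spherical_simps wedge_in_spherical absorb_in)
next case 2 show ?case by (auto simp: spherical_def wedge_def intro!: exI absorb_in)
next case 3 then show ?case
    by (auto elim!: spherical_carE simp: spherical_simps pmaps_le intro!: wedge_in_spherical)
next case 4 then show ?case by (simp add: spherical_simps pmaps_0)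
next case (5 a n)
  have "(\<lambda>i\<in>{0..n}. i) \<in> pmaps n n" by (auto simp: pmaps_def)
  then show ?case using 5 by (auto elim!: spherical_carE simp: spherical_simps)
next case (6 f n m g l a)
  then have "compose {0..n} g f \<in> pmaps n l" using pmaps_compose by blast
  then show ?case using 6 by (auto elim!: spherical_carE simp: spherical_simps) (simp add: compose_def)
next case 7 then show ?case by (simp add: spherical_simps wedge_in_spherical)
next case 8 then show ?case by (simp add: spherical_simps) (simp add: wedge_def)
next case 9 then show ?case by (simp add: spherical_simps pmaps_le)
next case 10 then show ?case
    by (auto elim!: spherical_carE simp: spherical_simps smash_le intro!: wedge_in_spherical)
next case 11 then show ?case
    by (auto elim!: spherical_carE simp: spherical_simps absorb_in) (simp add: wedge_def)
next case 12 then show ?case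
    by (auto elim!: spherical_carE simp: spherical_simps absorb_in) (simp add: wedge_def)
next case (13 f n n' g m m' a b)
  have sm: "smash_map n m m' f g \<in> pmaps (n * m) (n' * m')"
    using 13(1,2) smash_map_in_pmaps by blast
  show ?case using 13
    by (auto elim!: spherical_carE simp: spherical_simps sm smash_map_smash)
next case 14 then show ?case
    by (auto elim!: spherical_carE simp: spherical_simps smash_assoc m_assoc)
next case 15 then show ?case
    by (auto elim!: spherical_carE simp: spherical_simps) (auto simp: smash_def wedge_def)
next case 16 then show ?case
    by (auto elim!: spherical_carE simp: spherical_simps) (auto simp: smash_def wedge_def)
qed

lemma HR_F1_algebra: "F1_algebra (HR :: (nat \<Rightarrow> 'r::comm_ring_1) F1alg)"
proof -
  have pm: "f \<in> pmaps n m \<Longrightarrow> i \<le> n \<Longrightarrow> f i \<le> m" "f \<in> pmaps n m \<Longrightarrow> f 0 = 0" for f n m i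
    by (auto simp: pmaps_def PiE_def Pi_def)
  have s1: "k \<in> {1..n*m} \<Longrightarrow> smash_fst m k \<in> {1..n} \<and> smash_snd m k \<in> {1..m}" for k n m
    by (erule smash_cases) (auto simp: smash_fst_smash smash_snd_smash)
  show ?thesis
  proof (unfold_locales, goal_cases)
    case 1 show ?case by (simp add: HR_def)
  next case 2 show ?case by (auto simp: HR_def)
  next case 3 then show ?case by (auto simp: HR_def)
  next case 4 then show ?case by (auto simp: HR_def)
  next case (5 a n)
    have "(\<Sum>i\<in>{i \<in> {1..n}. (\<lambda>i\<in>{0..n}. i) i = k}. a i) = a k" if "k \<in> {1..n}" for k
    proof -
      have "{i \<in> {1..n}. (\<lambda>i\<in>{0..n}. i) i = k} = {k}" using that by auto
      then show ?thesis by simp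
    qed
    then show ?case using 5 by (auto simp: HR_def fun_eq_iff)
  next case (6 f n m g l a)
    have "(\<Sum>i\<in>{i \<in> {1..n}. compose {0..n} g f i = k}. a i) =
      (\<Sum>j\<in>{j \<in> {1..m}. g j = k}. if j \<in> {1..m} then \<Sum>i\<in>{i \<in> {1..n}. f i = j}. a i else 0)" 
      (is "?L = ?R") if "k \<in> {1..l}" for k
    proof -
      have "?R = (\<Sum>j\<in>{j \<in> {1..m}. g j = k}. \<Sum>i\<in>{i \<in> {1..n}. f i = j}. a i)"
        by (rule sum.cong) auto
      also have "\<dots> = (\<Sum>i\<in>(\<Union>j\<in>{j \<in> {1..m}. g j = k}. {i \<in> {1..n}. f i = j}). a i)"
        by (rule sum.UNION_disjoint[symmetric]) auto
      also have "(\<Union>j\<in>{j \<in> {1..m}. g j = k}. {i \<in> {1..n}. f i = j}) 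
          = {i \<in> {1..n}. compose {0..n} g f i = k}"
      proof -
        have "i \<in> {1..n} \<Longrightarrow> g (f i) = k \<Longrightarrow> f i \<in> {1..m}" for i
          using pm(1)[OF 6(1), of i] pm(2)[OF 6(2)] that by (cases "f i") auto
        then show ?thesis by (auto simp: compose_def)
      qed
      finally show ?thesis by simp
    qed
    then show ?case by (simp add: HR_def fun_eq_iff)
  next case 7 then show ?case by (auto simp: HR_def)
  next case 8 then show ?case by (auto simp: HR_def)
  next case (9 f n m i)
    have "(\<Sum>j\<in>{j \<in> {1..n}. f j = k}. if j = i \<and> i \<in> {1..n} then 1 else 0) = 
       (if k = f i \<and> f i \<in> {1..m} then 1 else (0::'r))" if k: "k \<in> {1..m}" for k
    proof (cases "i = 0")
      case True then show ?thesis using k pm(2)[OF 9(1)] by auto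
    next case False
      then have "(\<Sum>j\<in>{j \<in> {1..n}. f j = k}. if j = i \<and> i \<in> {1..n} then 1 else 0) =
        (\<Sum>j\<in>{j \<in> {1..n}. f j = k}. if j = i then 1 else (0::'r))"
        using 9 by (intro sum.cong) auto
      also have "\<dots> = (if i \<in> {j \<in> {1..n}. f j = k} then 1 else 0)" by (rule sum.delta) simp
      finally show ?thesis using 9(2) k False by auto
    qed
    then show ?case by (auto simp: HR_def fun_eq_iff)
  next case 10 then show ?case by (auto simp: HR_def)
  next case 11 then show ?case by (auto simp: HR_def)
  next case 12 then show ?case by (auto simp: HR_def)
  next case (13 f n n' g m m' a b)
    have "(\<Sum>k\<in>{k \<in> {1..n*m}. smash_map n m m' f g k = q}. 
            if k \<in> {1..n*m} then a (smash_fst m k) * b (smash_snd m k) else 0) =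
       (if smash_fst m' q \<in> {1..n'} then \<Sum>i\<in>{i\<in>{1..n}. f i = smash_fst m' q}. a i else 0) *
       (if smash_snd m' q \<in> {1..m'} then \<Sum>j\<in>{j\<in>{1..m}. g j = smash_snd m' q}. b j else 0)"
       (is "?L = ?R") if q: "q \<in> {1..n'*m'}" for q
    proof -
      from q obtain i' j' where q': "i' \<in> {1..n'}" "j' \<in> {1..m'}" "q = smash m' i' j'"
        by (rule smash_cases)
      then have qs: "smash_fst m' q = i'" "smash_snd m' q = j'"
        by (auto simp: smash_fst_smash smash_snd_smash)
      let ?I = "{i\<in>{1..n}. f i = i'} \<times> {j\<in>{1..m}. g j = j'}"
      have inj: "inj_on (\<lambda>(i,j). smash m i j) ?I"
      proof (rule inj_onI)
        fix x y assume xy: "x \<in> ?I" "y \<in> ?I" "(\<lambda>(i,j). smash m i j) x = (\<lambda>(i,j). smash m i j) y"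
        show "x = y"
        proof (cases x, cases y)
          fix i j i2 j2 assume e: "x = (i, j)" "y = (i2, j2)"
          have "smash m i j = smash m i2 j2" "0 < i" "0 < j" "j \<le> m" "0 < i2" "0 < j2" "j2 \<le> m"
            using xy e by auto
          from smash_inj[OF this] show "x = y" using e by simp
        qed
      qed
      have img: "{k \<in> {1..n*m}. smash_map n m m' f g k = q} = (\<lambda>(i,j). smash m i j) ` ?I"
      proof (intro Set.set_eqI iffI)
        fix k assume "k \<in> {k \<in> {1..n*m}. smash_map n m m' f g k = q}"
        then have k: "k \<in> {1..n*m}" "smash_map n m m' f g k = q" by auto
        from k(1) obtain i j where ij: "i \<in> {1..n}" "j \<in> {1..m}" "k = smash m i j" 
          by (rule smash_cases)
        then have e: "smash m' (f i) (g j) = smash m' i' j'" 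
          using k(2) q' smash_map_smash[OF 13(1,2), of i j] by simp
        then have "f i > 0" "g j > 0" using q' smash_eq_0[of m' i' j'] smash_eq_0[of m' "f i" "g j"] by auto
        moreover have "g j \<le> m'" using pm(1)[OF 13(2)] ij by auto
        ultimately have "f i = i'" "g j = j'"
          using e q' smash_inj[of m' "f i" "g j" i' j'] by simp_all
        then show "k \<in> (\<lambda>(i,j). smash m i j) ` ?I" using ij by auto
      next
        fix k assume "k \<in> (\<lambda>(i,j). smash m i j) ` ?I"
        then obtain i j where ij: "i \<in> {1..n}" "j \<in> {1..m}" "f i = i'" "g j = j'" "k = smash m i j" by auto
        then have "k \<le> n * m" "k \<noteq> 0" using smash_le[of i n j m] smash_eq_0[of m i j] by auto
        moreover have "smash_map n m m' f g k = q"
          using ij q' smash_map_smash[OF 13(1,2), of i j] by simp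
        ultimately show "k \<in> {k \<in> {1..n*m}. smash_map n m m' f g k = q}" by auto
      qed
      have "?L = (\<Sum>k\<in>(\<lambda>(i,j). smash m i j) ` ?I. a (smash_fst m k) * b (smash_snd m k))"
        by (rule sum.cong[OF img]) (use img in auto)
      also have "\<dots> = (\<Sum>(i,j)\<in>?I. a i * b j)"
        by (subst sum.reindex[OF inj]) (auto intro!: sum.cong simp: smash_fst_smash smash_snd_smash)
      also have "\<dots> = ?R"
        using q'(1,2) by (simp only: qs sum_product sum.cartesian_product if_True)
      finally show ?thesis .
    qed
    then show ?case by (simp add: HR_def fun_eq_iff)
  next case (14 a n b m c l)
    have "(if smash_fst l k \<in> {1..n*m} then a (smash_fst m (smash_fst l k)) * b (smash_snd m (smash_fst l k)) else 0)
         * c (smash_snd l k) =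
       a (smash_fst (m * l) k) *
       (if smash_snd (m * l) k \<in> {1..m*l} then b (smash_fst l (smash_snd (m * l) k)) * c (smash_snd l (smash_snd (m * l) k)) else 0)"
      if k: "k \<in> {1..n*m*l}" for k
    proof -
      from k obtain p r where p: "p \<in> {1..n*m}" "r \<in> {1..l}" "k = smash l p r" by (rule smash_cases)
      from p(1) obtain i j where ij: "i \<in> {1..n}" "j \<in> {1..m}" "p = smash m i j" by (rule smash_cases)
      have k': "k = smash (m*l) i (smash l j r)" using p ij by (simp add: smash_assoc)
      have jr: "0 < smash l j r" "smash l j r \<le> m * l" 
        using p ij smash_eq_0[of l j r] smash_le[of j m r l] by auto
      have e1: "smash_fst l k = p" "smash_snd l k = r" "smash_fst m p = i" "smash_snd m p = j"
        using p ij by (auto simp: smash_fst_smash smash_snd_smash)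
      have e2: "smash_fst (m*l) k = i" "smash_snd (m*l) k = smash l j r"
        "smash_fst l (smash l j r) = j" "smash_snd l (smash l j r) = r"
        using p(2) ij(1,2) jr unfolding k' by (simp_all add: smash_fst_smash smash_snd_smash)
      show ?thesis unfolding e1 e2 using p(1) jr by (simp add: mult.assoc)
    qed
    then show ?case by (simp add: HR_def fun_eq_iff mult.assoc)
  next case (15 a n)
    then show ?case
      by (auto simp: HR_def fun_eq_iff smash_fst_def smash_snd_def)
  next case 16 then show ?case
      by (auto simp: HR_def fun_eq_iff smash_fst_def smash_snd_def)
  qed
qed


subsection \<open>Homomorphisms\<close>

lemma pmonoid_homD:
  assumes "g \<in> pmonoid_hom M N"
  shows "x \<in> carrier M \<Longrightarrow> g x \<in> carrier N" "g (absorb M) = absorb N" "g \<one>\<^bsub>M\<^esub> = \<one>\<^bsub>N\<^esub>"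
    "x \<in> carrier M \<Longrightarrow> y \<in> carrier M \<Longrightarrow> g (x \<otimes>\<^bsub>M\<^esub> y) = g x \<otimes>\<^bsub>N\<^esub> g y"
  using assms by (auto simp: pmonoid_hom_def hom_def)

lemma spherical_map_wedge:
  assumes "g \<in> pmonoid_hom M N" "x \<in> carrier M" "j \<le> n"
  shows "spherical_map M N g n (wedge M x j) = wedge N (g x) j"
  using wedge_in_spherical[OF assms(2,3)] pmonoid_homD[OF assms(1)]
  by (auto simp: spherical_map_def wedge_def)

lemma spherical_map_hom:
  assumes "comm_pmonoid M" "comm_pmonoid N" "g \<in> pmonoid_hom M N"
  shows "spherical_map M N g \<in> F1_hom (spherical M) (spherical N)"
proof -
  interpret M: comm_pmonoid M by fact
  interpret N: comm_pmonoid N by fact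
  note [simp] = spherical_map_wedge[OF assms(3)] pmonoid_homD[OF assms(3)] M.absorb_in N.absorb_in
  show ?thesis
    unfolding F1_hom_def mem_Collect_eq
  proof (intro conjI allI ballI impI, goal_cases)
    case (1 n)
    show ?case
    proof (rule PiE_I)
      fix a assume "a \<in> car (spherical M) n"
      then show "spherical_map M N g n a \<in> car (spherical N) n"
        by (auto elim!: spherical_carE intro!: wedge_in_spherical)
    qed (simp add: spherical_map_def)
  next case 2 then show ?case by (simp add: M.spherical_simps N.spherical_simps)
  next case 3 then show ?case
      by (auto elim!: spherical_carE simp: M.spherical_simps N.spherical_simps pmaps_le)
  next case 4 then show ?case by (simp add: M.spherical_simps N.spherical_simps)
  next case 5 then show ?case
      by (auto elim!: spherical_carE simp: M.spherical_simps N.spherical_simps smash_le)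
  qed
qed

lemma to_HR_wedge:
  assumes "mult_map M f" "x \<in> carrier M" "j \<le> n"
  shows "to_HR M f n (wedge M x j) = (\<lambda>k. if k = j \<and> j \<noteq> 0 then f x else 0)"
  using wedge_in_spherical[OF assms(2,3)] assms(1)
  by (auto simp: to_HR_def wedge_def mult_map_def)

lemma prd_HR: "prd HR n m u v = (\<lambda>k. if k \<in> {1..n * m} then u (smash_fst m k) * v (smash_snd m k) else 0)"
  by (simp add: HR_def)

lemma to_HR_hom:
  assumes "comm_pmonoid M" "mult_map M f"
  shows "to_HR M f \<in> F1_hom (spherical M) HR"
proof -
  interpret M: comm_pmonoid M by fact
  note [simp] = to_HR_wedge[OF assms(2)] M.absorb_in
  show ?thesis
    unfolding F1_hom_def mem_Collect_eq
  proof (intro conjI allI ballI impI, goal_cases)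
    case (1 n)
    show ?case
    proof (rule PiE_I)
      fix a assume "a \<in> car (spherical M) n"
      then show "to_HR M f n a \<in> car HR n"
        by (auto elim!: spherical_carE simp: HR_def)
    qed (simp add: to_HR_def)
  next case 2 then show ?case by (simp add: M.spherical_simps HR_def)
  next case (3 n m g a) 
    then obtain x j where a: "a = wedge M x j" "x \<in> carrier M" "j \<le> n" by (auto elim!: spherical_carE)
    have "(\<Sum>i\<in>{i \<in> {1..n}. g i = k}. if i = j \<and> j \<noteq> 0 then f x else 0) 
      = (if k = g j \<and> g j \<noteq> 0 then f x else 0)" if "k \<in> {1..m}" for k
    proof (cases "j = 0")
      case True then show ?thesis using 3 by (simp add: pmaps_0)
    next
      case False
      then have "(\<Sum>i\<in>{i \<in> {1..n}. g i = k}. if i = j \<and> j \<noteq> 0 then f x else 0) =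
         (\<Sum>i\<in>{i \<in> {1..n}. g i = k}. if i = j then f x else 0)" by simp
      also have "\<dots> = (if k = g j \<and> g j \<noteq> 0 then f x else 0)"
        using False a that by (auto simp: sum.delta)
      finally show ?thesis .
    qed
    then show ?case using 3 a pmaps_le[OF 3(1), of j]
      by (auto simp: M.spherical_simps HR_def fun_eq_iff)
  next case 4 then show ?case using assms(2) by (auto simp: M.spherical_simps HR_def mult_map_def)
  next case (5 n m a b)
    then obtain x i y j where a: "a = wedge M x i" "b = wedge M y j" "x \<in> carrier M" "y \<in> carrier M"
      "i \<le> n" "j \<le> m" by (auto elim!: spherical_carE)
    have "(if k = smash m i j \<and> smash m i j \<noteq> 0 then f x * f y else 0) =
      (if k \<in> {1..n*m} then (if smash_fst m k = i \<and> i \<noteq> 0 then f x else 0) * (if smash_snd m k = j \<and> j \<noteq> 0 then f y else 0) else 0)" for k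
    proof (cases "k \<in> {1..n*m}")
      case True
      then obtain i' j' where k: "i' \<in> {1..n}" "j' \<in> {1..m}" "k = smash m i' j'" by (rule smash_cases)
      then have e: "smash_fst m k = i'" "smash_snd m k = j'" by (auto simp: smash_fst_smash smash_snd_smash)
      have iff: "k = smash m i j \<and> smash m i j \<noteq> 0 \<longleftrightarrow> i = i' \<and> j = j'"
      proof
        assume "k = smash m i j \<and> smash m i j \<noteq> 0"
        then show "i = i' \<and> j = j'"
          using e a(5,6) smash_fst_smash[of i j m] smash_snd_smash[of i j m] by (simp add: smash_eq_0)
      qed (use k in \<open>auto simp: smash_eq_0\<close>)
      show ?thesis unfolding iff e using True k(1,2)
        by (cases "i = i'"; cases "j = j'") simp_all
    next case False
      then have "\<not> (k = smash m i j \<and> smash m i j \<noteq> 0)"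
        using smash_le[OF a(5,6)] by (metis One_nat_def Suc_leI atLeastAtMost_iff not_gr_zero)
      then show ?thesis using False by (simp only: if_False)
    qed
    moreover have "f (x \<otimes>\<^bsub>M\<^esub> y) = f x * f y" using assms(2) a by (auto simp: mult_map_def)
    ultimately show ?case using a
      by (simp only: M.spherical_simps smash_le to_HR_wedge[OF assms(2)] M.m_closed prd_HR)
  qed
qed

lemma ev_to_HR: "mult_map M f \<Longrightarrow> x \<in> carrier M \<Longrightarrow> ev M (to_HR M f) x = f x"
  by (simp add: ev_def to_HR_wedge)

lemma hom_wedge:
  assumes "comm_pmonoid M" "h \<in> F1_hom (spherical M) HR" "x \<in> carrier M" "j \<le> n"
  shows "h n (wedge M x j) = (\<lambda>k. if k = j \<and> j \<noteq> 0 then ev M h x else 0)"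
proof -
  interpret M: comm_pmonoid M by fact
  let ?f = "\<lambda>i\<in>{0..1::nat}. if i = 0 then 0 else j"
  have f: "?f \<in> pmaps 1 n" using assms(4) by (auto simp: pmaps_def)
  have "h n (wedge M x j) = h n (act (spherical M) 1 n ?f (wedge M x 1))"
    using f by (simp add: M.spherical_simps)
  also have "\<dots> = act HR 1 n ?f (h 1 (wedge M x 1))"
    using assms(2) f wedge_in_spherical[OF assms(3), of 1 1] by (auto simp: F1_hom_def)
  also have "\<dots> = (\<lambda>k. if k = j \<and> j \<noteq> 0 then ev M h x else 0)"
  proof -
    have "{i\<in>{1..1}. ?f i = k} = (if k = j then {1} else {})" for k by auto
    then show ?thesis using assms(4) by (auto simp: HR_def ev_def fun_eq_iff)
  qed
  finally show ?thesis .
qed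

lemma ev_mult_map:
  assumes "comm_pmonoid M" "h \<in> F1_hom (spherical M) HR"
  shows "mult_map M (ev M h)"
proof -
  interpret M: comm_pmonoid M by fact
  have 0: "h 1 (base (spherical M) 1) = base HR 1" and 1: "h 1 (unt (spherical M) 1 1) = unt HR 1 1"
    using assms(2) by (auto simp: F1_hom_def)
  have 2: "h (1*1) (prd (spherical M) 1 1 a b) = prd HR 1 1 (h 1 a) (h 1 b)" 
    if "a \<in> car (spherical M) 1" "b \<in> car (spherical M) 1" for a b
    using assms(2) that unfolding F1_hom_def by blast
  show ?thesis unfolding mult_map_def
  proof (intro conjI ballI)
    have "wedge M (absorb M) 1 = base (spherical M) 1" by (simp add: spherical_def wedge_def)
    then show "ev M h (absorb M) = 0" unfolding ev_def using 0 by (simp add: HR_def)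
    show "ev M h \<one>\<^bsub>M\<^esub> = 1" unfolding ev_def using 1 by (simp add: M.spherical_simps) (simp add: HR_def)
    fix x y assume xy: "x \<in> carrier M" "y \<in> carrier M"
    show "ev M h (x \<otimes>\<^bsub>M\<^esub> y) = ev M h x * ev M h y"
      using 2[OF wedge_in_spherical[OF xy(1), of 1] wedge_in_spherical[OF xy(2), of 1]] xy
      by (simp add: M.spherical_simps smash_def ev_def) (simp add: HR_def smash_fst_def smash_snd_def)
  qed
qed

lemma to_HR_ev:
  assumes "comm_pmonoid M" "h \<in> F1_hom (spherical M) HR"
  shows "to_HR M (ev M h) = h"
proof (rule ext, rule ext)
  fix n a
  show "to_HR M (ev M h) n a = h n a"
  proof (cases "a \<in> car (spherical M) n")
    case True
    then obtain x j where "a = wedge M x j" "x \<in> carrier M" "j \<le> n" by (auto elim!: spherical_carE)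
    then show ?thesis by (simp only: hom_wedge[OF assms] to_HR_wedge[OF ev_mult_map[OF assms]])
  next case False
    have "h n \<in> car (spherical M) n \<rightarrow>\<^sub>E car HR n" using assms(2) unfolding F1_hom_def mem_Collect_eq by (elim conjE allE[of _ n])
    from PiE_arb[OF this False] show ?thesis using False unfolding to_HR_def restrict_def by (simp only: if_False)
  qed
qed


lemma F1_comp_to_HR:
  assumes g: "g \<in> pmonoid_hom M N" and f: "mult_map N f"
  shows "F1_comp (spherical M) (to_HR N f) (spherical_map M N g) = to_HR M (f \<circ> g)"
proof -
  have m: "mult_map M (f \<circ> g)"
    using f unfolding mult_map_def comp_def by (simp add: pmonoid_homD[OF g])
  have star: "compose (car (spherical M) n) (to_HR N f n) (spherical_map M N g n) a = to_HR M (f \<circ> g) n a" for n a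
  proof (cases "a \<in> car (spherical M) n")
    case True
    then obtain x j where a: "a = wedge M x j" "x \<in> carrier M" "j \<le> n" by (rule spherical_carE)
    show ?thesis
      unfolding compose_eq[OF True] unfolding a(1) spherical_map_wedge[OF g a(2,3)]
        to_HR_wedge[OF m a(2,3)] to_HR_wedge[OF f pmonoid_homD(1)[OF g a(2)] a(3)] by (simp only: o_apply)
  qed (simp add: compose_def to_HR_def)
  show ?thesis unfolding F1_comp_def by (rule ext, rule ext, rule star)
qed

lemma F1_comp_spherical_map:
  assumes g: "g \<in> pmonoid_hom M N" and g': "g' \<in> pmonoid_hom N P"
  shows "F1_comp (spherical M) (spherical_map N P g') (spherical_map M N g) = spherical_map M P (g' \<circ> g)"
proof -
  have c: "g' \<circ> g \<in> pmonoid_hom M P"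
    using pmonoid_homD[OF g] pmonoid_homD[OF g'] by (simp add: pmonoid_hom_def hom_def Pi_def)
  have star: "compose (car (spherical M) n) (spherical_map N P g' n) (spherical_map M N g n) a = spherical_map M P (g' \<circ> g) n a" for n a
  proof (cases "a \<in> car (spherical M) n")
    case True
    then obtain x j where a: "a = wedge M x j" "x \<in> carrier M" "j \<le> n" by (rule spherical_carE)
    show ?thesis
      unfolding compose_eq[OF True] unfolding a(1) spherical_map_wedge[OF g a(2,3)]
        spherical_map_wedge[OF c a(2,3)] spherical_map_wedge[OF g' pmonoid_homD(1)[OF g a(2)] a(3)] by (simp only: o_apply)
  qed (simp add: compose_def spherical_map_def)
  show ?thesis unfolding F1_comp_def by (rule ext, rule ext, rule star)
qed

lemma fst_wedge_in: "a \<in> car (spherical M) n \<Longrightarrow> absorb M \<in> carrier M \<Longrightarrow> fst a \<in> carrier M"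
  by (erule spherical_carE) (simp add: wedge_def)

lemma spherical_map_cong:
  assumes "\<And>x. x \<in> carrier M \<Longrightarrow> g x = g' x" "absorb M \<in> carrier M"
  shows "spherical_map M N g = spherical_map M N g'"
  unfolding spherical_map_def
  by (intro ext restrict_ext) (use assms fst_wedge_in[OF _ assms(2)] in simp)

lemma to_HR_cong:
  assumes "\<And>x. x \<in> carrier M \<Longrightarrow> f x = f' x" "absorb M \<in> carrier M"
  shows "to_HR M f = to_HR M f'"
  unfolding to_HR_def
  by (intro ext arg_cong2[where f = restrict] refl) (use assms fst_wedge_in[OF _ assms(2)] in \<open>simp add: restrict_def\<close>)

subsection \<open>The structure sheaf and \<open>\<alpha>\<close>\<close>

lemma O_mon_simps [simp]:
  "absorb (O_mon U) = Zero" "\<one>\<^bsub>O_mon U\<^esub> = tj_one" "x \<otimes>\<^bsub>O_mon U\<^esub> y = tj_mult x y"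
  "Zero \<in> carrier (O_mon U)"
  "Mon a k b \<in> carrier (O_mon U) \<longleftrightarrow> (Plus \<in> U \<longrightarrow> k \<ge> 0) \<and> (Minus \<in> U \<longrightarrow> k \<le> 0)"
  "absorb eps_monoid = Zero" "\<one>\<^bsub>eps_monoid\<^esub> = tj_one" "x \<otimes>\<^bsub>eps_monoid\<^esub> y = tj_mult x y"
  "carrier eps_monoid = {Zero, tj_one, tj_eps}"
  by (auto simp: O_mon_def eps_monoid_def tj_monoid_def)

lemma eps_id_hom: "id \<in> pmonoid_hom eps_monoid (O_mon U)"
  by (auto simp: pmonoid_hom_def hom_def)

lemma O_X_structure: "snd (O_X U) \<in> F1_hom F12 (fst (O_X U))"
  using spherical_map_hom[OF comm_pmonoid_eps_monoid comm_pmonoid_O_mon eps_id_hom]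
  by (simp add: O_X_def F12_def)

lemma eps_sign_mult_map: "mult_map eps_monoid (eps_sign :: tj \<Rightarrow> 'r::comm_ring_1)"
  by (auto simp: mult_map_def)

lemma HR12_structure: "snd (HR12 :: (nat \<Rightarrow> 'r::comm_ring_1) F12alg) \<in> F1_hom F12 (fst HR12)"
  using to_HR_hom[OF comm_pmonoid_eps_monoid eps_sign_mult_map]
  by (simp add: HR12_def F12_def)

lemma rho_mon_hom:
  assumes "V \<subseteq> U"
  shows "rho_mon U V \<in> pmonoid_hom (O_mon U) (O_mon V)"
proof -
  have "rho_mon U V x \<in> carrier (O_mon V)" if "x \<in> carrier (O_mon U)" for x
    using that assms by (cases x) auto
  moreover have "rho_mon U V (tj_mult x y) = tj_mult (rho_mon U V x) (rho_mon U V y)" for x y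
    by (cases x; cases y) auto
  ultimately show ?thesis by (auto simp: pmonoid_hom_def hom_def)
qed

lemma alpha_mon_hom: "alpha_mon U \<in> pmonoid_hom (O_mon U) (O_mon (alpha_pt -` U))"
proof -
  have "alpha_mon U x \<in> carrier (O_mon (alpha_pt -` U))" if "x \<in> carrier (O_mon U)" for x
    using that by (cases x) auto
  moreover have "alpha_mon U (tj_mult x y) = tj_mult (alpha_mon U x) (alpha_mon U y)" for x y
    by (cases x; cases y) auto
  ultimately show ?thesis by (auto simp: pmonoid_hom_def hom_def)
qed

lemma rho_F12_hom:
  assumes "V \<subseteq> U"
  shows "rho U V \<in> F12_hom (O_X U) (O_X V)"
proof -
  have "spherical_map eps_monoid (O_mon V) (rho_mon U V \<circ> id) = spherical_map eps_monoid (O_mon V) id"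
    by (rule spherical_map_cong) auto
  then show ?thesis
    using spherical_map_hom[OF comm_pmonoid_O_mon comm_pmonoid_O_mon rho_mon_hom[OF assms]]
      F1_comp_spherical_map[OF eps_id_hom rho_mon_hom[OF assms]]
    by (simp add: F12_hom_def O_X_def rho_def F12_def)
qed

lemma alpha_star_F12_hom: "alpha_star U \<in> F12_hom (O_X U) (O_X (alpha_pt -` U))"
proof -
  have "spherical_map eps_monoid (O_mon (alpha_pt -` U)) (alpha_mon U \<circ> id) = spherical_map eps_monoid (O_mon (alpha_pt -` U)) id"
    by (rule spherical_map_cong) auto
  then show ?thesis
    using spherical_map_hom[OF comm_pmonoid_O_mon comm_pmonoid_O_mon alpha_mon_hom]
      F1_comp_spherical_map[OF eps_id_hom alpha_mon_hom]
    by (simp add: F12_hom_def O_X_def alpha_star_def F12_def)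
qed

lemma F12_hom_iff:
  "h \<in> F12_hom (O_X U) HR12 \<longleftrightarrow> (\<exists>f. mult_map (O_mon U) f \<and> f tj_eps = - 1 \<and> h = to_HR (O_mon U) f)"
proof -
  have key: "F1_comp F12 (to_HR (O_mon U) f) (snd (O_X U)) = snd HR12 \<longleftrightarrow> f tj_eps = - 1"
    if f: "mult_map (O_mon U) f" for f :: "tj \<Rightarrow> 'r::comm_ring_1"
  proof -
    have 1: "F1_comp F12 (to_HR (O_mon U) f) (snd (O_X U)) = to_HR eps_monoid f"
      using F1_comp_to_HR[OF eps_id_hom f] by (simp add: F12_def O_X_def)
    have "f (tj_mult tj_eps tj_eps) = f tj_eps * f tj_eps"
      using f unfolding mult_map_def O_mon_simps(3) by (metis O_mon_simps(5) order_refl)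
    then have mf: "mult_map eps_monoid f" using f by (auto simp: mult_map_def)
    show ?thesis unfolding 1 HR12_def snd_conv
    proof
      assume "to_HR eps_monoid f = to_HR eps_monoid eps_sign"
      then have "ev eps_monoid (to_HR eps_monoid f) tj_eps = ev eps_monoid (to_HR eps_monoid eps_sign) tj_eps" by simp
      then show "f tj_eps = - 1" by (simp add: ev_to_HR[OF mf] ev_to_HR[OF eps_sign_mult_map])
    next
      assume "f tj_eps = - 1"
      then show "to_HR eps_monoid f = to_HR eps_monoid eps_sign"
        by (intro to_HR_cong) (use mf in \<open>auto simp: mult_map_def\<close>)
    qed
  qed
  have O: "fst (O_X U) = spherical (O_mon U)" "fst HR12 = HR" by (simp_all add: O_X_def HR12_def)
  show ?thesis
  proof
    assume h: "h \<in> F12_hom (O_X U) HR12"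
    then have h1: "h \<in> F1_hom (spherical (O_mon U)) HR" "F1_comp F12 h (snd (O_X U)) = snd HR12"
      by (simp_all add: F12_hom_def O)
    note e = to_HR_ev[OF comm_pmonoid_O_mon h1(1)] and m = ev_mult_map[OF comm_pmonoid_O_mon h1(1)]
    show "\<exists>f. mult_map (O_mon U) f \<and> f tj_eps = - 1 \<and> h = to_HR (O_mon U) f"
      using key[OF m] e m h1(2) by metis
  next
    assume "\<exists>f. mult_map (O_mon U) f \<and> f tj_eps = - 1 \<and> h = to_HR (O_mon U) f"
    then show "h \<in> F12_hom (O_X U) HR12"
      using key to_HR_hom[OF comm_pmonoid_O_mon] by (auto simp: F12_hom_def O)
  qed
qed


lemma alpha_pt_involutive: "alpha_pt (alpha_pt x) = x"
  by (cases x) auto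

lemma alpha_pt_image: "alpha_pt ` U = alpha_pt -` U"
  by (auto simp: alpha_pt_involutive) (metis alpha_pt_involutive image_eqI)

lemma alpha_pt_vimage_Omega: "alpha_pt -` U = Omega \<longleftrightarrow> U = Omega"
proof -
  have "alpha_pt -` U = Omega \<longleftrightarrow> (\<forall>x. alpha_pt x \<in> U \<longleftrightarrow> x \<in> Omega)" by auto
  also have "\<dots> \<longleftrightarrow> (\<forall>x. x \<in> U \<longleftrightarrow> x \<in> Omega)"
    by (auto simp: all_xpt Omega_def Omega_plus_def Omega_minus_def)
  finally show ?thesis by blast
qed

lemma alpha_pt_vimage_vimage: "alpha_pt -` (alpha_pt -` U) = U"
  by (auto simp: alpha_pt_involutive)

lemma alpha_pt_vimage_X_opens: "U \<in> X_opens \<Longrightarrow> alpha_pt -` U \<in> X_opens"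
proof -
  have "alpha_pt -` Omega_plus = Omega_minus" "alpha_pt -` Omega_minus = Omega_plus"
    by (simp_all add: set_eq_iff all_xpt Omega_plus_def Omega_minus_def)
  then show "U \<in> X_opens \<Longrightarrow> alpha_pt -` U \<in> X_opens"
    using alpha_pt_vimage_Omega[of Omega] by (auto simp: X_opens_eq)
qed

lemma alpha_mon_involutive: "alpha_mon (alpha_pt -` U) (alpha_mon U x) = x"
  by (cases x) (auto simp: alpha_pt_vimage_Omega)

lemma mult_map_comp:
  "g \<in> pmonoid_hom M N \<Longrightarrow> mult_map N f \<Longrightarrow> mult_map M (f \<circ> g)"
  unfolding mult_map_def comp_def by (simp add: pmonoid_homD)

lemma alpha_mon_hom':
  "alpha_mon (alpha_pt -` U) \<in> pmonoid_hom (O_mon (alpha_pt -` U)) (O_mon U)"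
  using alpha_mon_hom[of "alpha_pt -` U"] by (simp only: alpha_pt_vimage_vimage)

lemma alpha_pre_to_HR:
  assumes "mult_map (O_mon U) f"
  shows "alpha_pre (U, to_HR (O_mon U) f) =
    (alpha_pt -` U, to_HR (O_mon (alpha_pt -` U)) (f \<circ> alpha_mon (alpha_pt -` U)))"
  using F1_comp_to_HR[OF alpha_mon_hom' assms]
  by (simp add: alpha_pre_def Let_def alpha_pt_image O_X_def alpha_star_def alpha_pt_vimage_vimage)

lemma alpha_pre_in:
  assumes "p \<in> pre_points"
  shows "alpha_pre p \<in> pre_points"
proof -
  from assms obtain U f where p: "p = (U, to_HR (O_mon U) f)" "U \<in> X_opens" "mult_map (O_mon U) f" "f tj_eps = - 1"
    by (auto simp: pre_points_def F12_hom_iff)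
  have "(f \<circ> alpha_mon (alpha_pt -` U)) tj_eps = - 1" using p(4) by simp
  then show ?thesis
    using mult_map_comp[OF alpha_mon_hom' p(3)] alpha_pt_vimage_X_opens[OF p(2)]
    unfolding p(1) alpha_pre_to_HR[OF p(3)] pre_points_def
    by (auto simp only: F12_hom_iff mem_Sigma_iff)
qed

lemma alpha_pre_involutive:
  assumes "p \<in> pre_points"
  shows "alpha_pre (alpha_pre p) = p"
proof -
  from assms obtain U f where p: "p = (U, to_HR (O_mon U) f)" "mult_map (O_mon U) f"
    by (auto simp: pre_points_def F12_hom_iff)
  have "f \<circ> alpha_mon (alpha_pt -` U) \<circ> alpha_mon U = f"
    by (simp add: fun_eq_iff alpha_mon_involutive)
  then show ?thesis
    using alpha_pre_to_HR[OF mult_map_comp[OF alpha_mon_hom' p(2)]]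
    unfolding p(1) alpha_pre_to_HR[OF p(2)] by (simp only: alpha_pt_vimage_vimage)
qed

lemma alpha_rho_mon:
  assumes "U \<in> X_opens" "V \<in> X_opens" "V \<subseteq> U"
  shows "rho_mon U V (alpha_mon (alpha_pt -` U) x)
    = alpha_mon (alpha_pt -` V) (rho_mon (alpha_pt -` U) (alpha_pt -` V) x)"
proof -
  have m: "Plus \<in> Omega_plus" "Minus \<notin> Omega_plus" "Minus \<in> Omega_minus" "Plus \<notin> Omega_minus"
    "Plus \<notin> Omega" "Minus \<notin> Omega"
    by (simp_all add: Omega_def Omega_plus_def Omega_minus_def)
  have W: "W = Omega \<longleftrightarrow> Plus \<notin> W \<and> Minus \<notin> W" "Plus \<notin> W \<or> Minus \<notin> W" if "W \<in> X_opens" for W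
    using that m unfolding X_opens_eq by blast+
  have vim: "Minus \<in> alpha_pt -` W \<longleftrightarrow> Plus \<in> W" for W by simp
  show ?thesis
  proof (cases x)
    case (Mon a k b)
    show ?thesis
      unfolding Mon alpha_mon.simps rho_mon.simps alpha_pt_vimage_Omega vim W(1)[OF assms(1)] W(1)[OF assms(2)]
      using W(2)[OF assms(1)] W(2)[OF assms(2)] subsetD[OF assms(3), of Plus] subsetD[OF assms(3), of Minus]
      by (simp only: tj.inject simp_thms) argo
  qed simp
qed

lemma alpha_pre_glue:
  assumes "(p, q) \<in> glue"
  shows "(alpha_pre p, alpha_pre q) \<in> glue"
proof -
  from assms obtain U V f where *: "U \<in> X_opens" "V \<in> X_opens" "V \<subseteq> U" "mult_map (O_mon V) f" "f tj_eps = - 1"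
    "p = (V, to_HR (O_mon V) f)" "q = (U, F1_comp (fst (O_X U)) (to_HR (O_mon V) f) (rho U V))"
    by (auto simp: glue_def F12_hom_iff)
  let ?U = "alpha_pt -` U" and ?V = "alpha_pt -` V"
  let ?f = "f \<circ> alpha_mon ?V"
  have q: "q = (U, to_HR (O_mon U) (f \<circ> rho_mon U V))"
    using F1_comp_to_HR[OF rho_mon_hom[OF *(3)] *(4)] *(7) by (simp add: O_X_def rho_def)
  have sub: "?V \<subseteq> ?U" using *(3) by auto
  have mf: "mult_map (O_mon ?V) ?f" by (rule mult_map_comp[OF alpha_mon_hom' *(4)])
  have "f \<circ> rho_mon U V \<circ> alpha_mon ?U = ?f \<circ> rho_mon ?U ?V"
    using alpha_rho_mon[OF *(1-3)] by (simp add: fun_eq_iff)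
  then have "alpha_pre q = (?U, to_HR (O_mon ?U) (?f \<circ> rho_mon ?U ?V))"
    using alpha_pre_to_HR[OF mult_map_comp[OF rho_mon_hom[OF *(3)] *(4)]] q by simp
  also have "\<dots> = (?U, F1_comp (fst (O_X ?U)) (to_HR (O_mon ?V) ?f) (rho ?U ?V))"
    using F1_comp_to_HR[OF rho_mon_hom[OF sub] mf] by (simp add: O_X_def rho_def)
  finally have q': "alpha_pre q = \<dots>" .
  have p': "alpha_pre p = (?V, to_HR (O_mon ?V) ?f)"
    using alpha_pre_to_HR[OF *(4)] *(6) by simp
  have "?f tj_eps = - 1" using *(5) by simp
  then have "to_HR (O_mon ?V) ?f \<in> F12_hom (O_X ?V) HR12" using mf by (auto simp only: F12_hom_iff)
  then show ?thesis
    unfolding p' q' glue_def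
    using alpha_pt_vimage_X_opens[OF *(1)] alpha_pt_vimage_X_opens[OF *(2)] sub by blast
qed

end

theory Submission
  imports Defs
begin

text \<open>
  A homomorphism \<open>\<O>(U) \<rightarrow> HK\<close> is determined by the values \<open>z\<close> of \<open>T\<close> and \<open>j\<close> of \<open>J\<close>, where
  \<open>j\<^sup>2 = - 1\<close>.  Gluing the charts, with the sign of \<open>J\<^sub>-\<close> reversed because \<open>J\<^sub>- \<mapsto> \<epsilon> J\<close>, identifies
  \<open>\<X>(K)\<close> with \<open>P\<^sup>1(K) \<times> {j. j\<^sup>2 = - 1}\<close>.  In these coordinates \<open>\<alpha>\<close> is \<open>(z, j) \<mapsto> (- 1 / z, - j)\<close>, so over
  the complex numbers every \<open>\<alpha>\<close>-orbit has a unique representative with \<open>j = \<i>\<close>.  Conjugation maps \<open>(z, \<i>)\<close>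
  to \<open>(cnj z, - \<i>)\<close>, which lies in the orbit of \<open>(- 1 / cnj z, \<i>)\<close>.
\<close>

section \<open>The nontrivial open sets and their inclusions\<close>

lemma Plus_Minus_simps [simp]:
  "Plus \<in> Omega_plus" "Minus \<notin> Omega_plus" "Plus \<notin> Omega_minus" "Minus \<in> Omega_minus"
  "Plus \<notin> Omega" "Minus \<notin> Omega"
  by (simp_all add: Omega_def Omega_plus_def Omega_minus_def)

lemma Omega_distinct [simp]:
  "Omega_plus \<noteq> Omega_minus" "Omega_minus \<noteq> Omega_plus" "Omega_plus \<noteq> Omega"
  "Omega \<noteq> Omega_plus" "Omega_minus \<noteq> Omega" "Omega \<noteq> Omega_minus"
  using Plus_Minus_simps by blast+

lemma alpha_pt_vimage_simps [simp]:
  "alpha_pt -` Omega_plus = Omega_minus" "alpha_pt -` Omega_minus = Omega_plus"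
  "alpha_pt -` Omega = Omega"
  by (simp_all add: set_eq_iff all_xpt Omega_def Omega_plus_def Omega_minus_def)

lemma X_opens_cases:
  assumes "U \<in> X_opens"
  obtains "U = Omega_plus" | "U = Omega_minus" | "U = Omega"
  using assms by (auto simp: X_opens_eq)

lemma X_opens_simps [simp]:
  "Omega_plus \<in> X_opens" "Omega_minus \<in> X_opens" "Omega \<in> X_opens"
  by (simp_all add: X_opens_eq)

lemma Omega_subset [simp]:
  "Omega \<subseteq> Omega_plus" "Omega \<subseteq> Omega_minus"
  by (simp_all add: Omega_def)

lemma X_opens_subset_cases:
  assumes "U \<in> X_opens" "V \<in> X_opens" "V \<subseteq> U"
  obtains "U = V" | "U = Omega_plus" "V = Omega" | "U = Omega_minus" "V = Omega"
  using assms Plus_Minus_simps unfolding X_opens_eq by blast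

section \<open>Parameters for homomorphisms to HK\<close>

text \<open>
  On \<open>Omega_minus\<close> only \<open>k \<le> 0\<close> occurs, so \<open>z\<close> stands for the inverse of the value of
  \<open>T\<^sup>-\<^sup>1\<close>, and the conventions \<open>inverse 0 = 0\<close> and \<open>0 powi 0 = 1\<close> let \<open>z = 0\<close> represent the
  point at infinity.
\<close>

fun tj_eval :: "'k::field \<Rightarrow> 'k \<Rightarrow> tj \<Rightarrow> 'k" where
  "tj_eval z j Zero = 0"
| "tj_eval z j (Mon a k b) = (if a then - 1 else 1) * (z powi k) * (if b then j else 1)"

text \<open>T is invertible over \<open>Omega\<close>, so z = 0 is excluded there. On the charts z =
  0 is the origin of \<open>Omega_plus\<close> or the point at infinity in
  \<open>Omega_minus\<close>.\<close>

definition tj_params :: "(xpt set \<times> 'k::field \<times> 'k) set" where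
  "tj_params = {(U, z, j). U \<in> X_opens \<and> (z = 0 \<longrightarrow> U \<noteq> Omega) \<and> j * j = - 1}"

definition tj_point :: "xpt set \<Rightarrow> 'k::field \<Rightarrow> 'k \<Rightarrow> 'k pre_point" where
  "tj_point U z j = (U, to_HR (O_mon U) (tj_eval z j))"

lemma fst_tj_point [simp]: "fst (tj_point U z j) = U"
  by (simp add: tj_point_def)

lemma mult_map_tj_eval:
  assumes "(U, z, j) \<in> tj_params"
  shows "mult_map (O_mon U) (tj_eval z j)"
proof -
  from assms have U: "U \<in> X_opens" and z: "z = 0 \<longrightarrow> U \<noteq> Omega" and j: "j * j = - 1"
    by (auto simp: tj_params_def)
  have add: "z powi (k + k') = z powi k * z powi k'"
    if "Mon a k b \<in> carrier (O_mon U)" "Mon a' k' b' \<in> carrier (O_mon U)" for a k b a' k' b'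
  proof (cases "z \<noteq> 0 \<or> k + k' \<noteq> 0")
    case True
    then show ?thesis by (rule power_int_add)
  next
    case False
    \<comment> \<open>Here z = 0, so \<open>U\<close> is one of the two charts; its exponents all
      have the same sign, so a zero sum forces both to vanish.\<close>
    with U z that have "k = 0 \<and> k' = 0" by (elim X_opens_cases) auto
    then show ?thesis by simp
  qed
  have "tj_eval z j (tj_mult x y) = tj_eval z j x * tj_eval z j y"
    if "x \<in> carrier (O_mon U)" "y \<in> carrier (O_mon U)" for x y
  proof (cases "x = Zero \<or> y = Zero")
    case False
    then obtain a k b a' k' b' where "x = Mon a k b" "y = Mon a' k' b'"
      by (metis tj.exhaust)
    with add[of a k b a' k' b'] that j show ?thesis
      by (auto simp: mult.assoc mult.left_commute)
  qed (use that in \<open>cases x; cases y; auto\<close>)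
  then show ?thesis by (simp add: mult_map_def)
qed

text \<open>The factor \<open>s\<close> is instantiated to 1 and to -1, so that one induction covers
  powers of T and of its inverse.\<close>

lemma mult_map_tj_T_power:
  assumes "mult_map (O_mon U) f" "tj_T s \<in> carrier (O_mon U)"
  shows "f (tj_T (s * int n)) = f (tj_T s) ^ n"
proof (induction n)
  case 0
  show ?case using assms(1) by (simp add: mult_map_def)
next
  case (Suc n)
  have "tj_T (s * int n) \<in> carrier (O_mon U)"
    using assms(2) by (auto simp: zero_le_mult_iff mult_le_0_iff)
  with assms have "f (tj_mult (tj_T s) (tj_T (s * int n))) = f (tj_T s) * f (tj_T (s * int n))"
    unfolding mult_map_def by (metis O_mon_simps(3))
  then show ?case using Suc by (simp add: algebra_simps)
qed

text \<open>Every monomial is a product of \<open>tj_eps\<close>, \<open>tj_J\<close> and a power of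
  T, and the value at \<open>tj_eps\<close> is prescribed. Agreement is claimed on the carrier only,
  which is all that \<open>to_HR\<close> sees.\<close>

lemma tj_eval_surj:
  fixes f :: "tj \<Rightarrow> 'k::field"
  assumes U: "U \<in> X_opens" and f: "mult_map (O_mon U) f" and eps: "f tj_eps = - 1"
  obtains z j where "(U, z, j) \<in> tj_params" "\<And>x. x \<in> carrier (O_mon U) \<Longrightarrow> f x = tj_eval z j x"
proof
  \<comment> \<open>T is not a section over \<open>Omega_minus\<close>, so its value is recovered
    there from the inverse of T.\<close>
  define z where "z = (if U = Omega_minus then inverse (f (tj_T (- 1))) else f (tj_T 1))"
  define j where "j = f tj_J"
  have mult: "f (tj_mult x y) = f x * f y"
    if "x \<in> carrier (O_mon U)" "y \<in> carrier (O_mon U)" for x y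
    using f that by (auto simp: mult_map_def)
  have f0: "f Zero = 0" and f1: "f tj_one = 1" using f by (auto simp: mult_map_def)
  have inv: "f (tj_T 1) * f (tj_T (- 1)) = 1" if "U = Omega"
    using mult[of "tj_T 1" "tj_T (- 1)"] f1 that by simp
  have j: "j * j = - 1" using mult[of tj_J tj_J] eps by (simp add: j_def)
  show "(U, z, j) \<in> tj_params"
    using U j inv by (auto simp: tj_params_def z_def)
  have nonneg: "f (tj_T k) = z powi k" if "0 \<le> k" "U \<noteq> Omega_minus" for k
    using mult_map_tj_T_power[OF f, of 1 "nat k"] U that
    by (elim X_opens_cases) (auto simp: z_def power_int_def)
  have nonpos: "f (tj_T k) = z powi k" if "k \<le> 0" "U \<noteq> Omega_plus" for k
  proof -
    have "inverse z = f (tj_T (- 1))"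
      using U that inv by (elim X_opens_cases) (auto simp: z_def intro: inverse_unique)
    then show ?thesis
      using mult_map_tj_T_power[OF f, of "- 1" "nat (- k)"] U that
      by (elim X_opens_cases) (auto simp: power_int_def)
  qed
  have T: "f (tj_T k) = z powi k" if "tj_T k \<in> carrier (O_mon U)" for k
    using U that nonneg[of k] nonpos[of k] by (elim X_opens_cases; cases "0 \<le> k") auto
  fix x assume x: "x \<in> carrier (O_mon U)"
  show "f x = tj_eval z j x"
  proof (cases x)
    case (Mon a k b)
    have "f (Mon a 0 b) = (if a then - 1 else 1) * (if b then j else 1)"
      using mult[of tj_eps tj_J] eps f1 by (cases a; cases b) (auto simp: j_def)
    moreover have "f x = f (Mon a 0 b) * f (tj_T k)"
      using mult[of "Mon a 0 b" "tj_T k"] x Mon by simp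
    ultimately show ?thesis using T[of k] x Mon by simp
  qed (simp add: f0)
qed

lemma tj_point_in_pre_points: "(U, z, j) \<in> tj_params \<Longrightarrow> tj_point U z j \<in> pre_points"
  using mult_map_tj_eval[of U z j]
  by (auto simp: tj_point_def pre_points_def F12_hom_iff tj_params_def)

lemma snd_tj_point_F12_hom:
  "(U, z, j) \<in> tj_params \<Longrightarrow> snd (tj_point U z j) \<in> F12_hom (O_X U) HR12"
  using tj_point_in_pre_points[of U z j] by (simp add: tj_point_def pre_points_def)

lemma pre_points_cases:
  assumes "p \<in> pre_points"
  obtains U z j where "(U, z, j) \<in> tj_params" "p = tj_point U z j"
proof -
  from assms obtain U f where p: "U \<in> X_opens" "mult_map (O_mon U) f" "f tj_eps = - 1"
    "p = (U, to_HR (O_mon U) f)"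
    by (auto simp: pre_points_def F12_hom_iff)
  from tj_eval_surj[OF p(1-3)] obtain z j where zj: "(U, z, j) \<in> tj_params"
    "\<And>x. x \<in> carrier (O_mon U) \<Longrightarrow> f x = tj_eval z j x"
    by blast
  have "to_HR (O_mon U) f = to_HR (O_mon U) (tj_eval z j)"
    by (rule to_HR_cong) (auto simp: zj(2))
  with p(4) zj(1) that show ?thesis by (simp add: tj_point_def)
qed

section \<open>Gluing, the involution and conjugation in terms of parameters\<close>

lemma restrict_tj_point:
  assumes "(V, z, j) \<in> tj_params" "V \<subseteq> U"
  shows "(U, F1_comp (fst (O_X U)) (snd (tj_point V z j)) (rho U V))
    = tj_point U z (if Minus \<in> U \<and> Minus \<notin> V then - j else j)"
proof -
  \<comment> \<open>Restriction from \<open>Omega_minus\<close> multiplies J by \<epsilon>, which is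
    evaluated to -1.\<close>
  have "tj_eval z j \<circ> rho_mon U V = tj_eval z (if Minus \<in> U \<and> Minus \<notin> V then - j else j)"
  proof
    fix x show "(tj_eval z j \<circ> rho_mon U V) x = tj_eval z (if Minus \<in> U \<and> Minus \<notin> V then - j else j) x"
      by (cases x) auto
  qed
  then show ?thesis
    using F1_comp_to_HR[OF rho_mon_hom[OF assms(2)] mult_map_tj_eval[OF assms(1)]]
    by (simp add: tj_point_def O_X_def rho_def)
qed

text \<open>Apart from identities, the only inclusions between nontrivial open sets are those of
  \<open>Omega\<close> into the two charts.\<close>

lemma glue_cases:
  assumes "(p, q) \<in> glue"
  obtains (refl) "q = p" "p \<in> pre_points"
  | (plus) z j where "(Omega, z, j) \<in> tj_params" "p = tj_point Omega z j" "q = tj_point Omega_plus z j"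
  | (minus) z j where "(Omega, z, j) \<in> tj_params" "p = tj_point Omega z j" "q = tj_point Omega_minus z (- j)"
proof -
  from assms obtain U V h where *: "U \<in> X_opens" "V \<in> X_opens" "V \<subseteq> U" "(V, h) \<in> pre_points"
    "p = (V, h)" "q = (U, F1_comp (fst (O_X U)) h (rho U V))"
    by (auto simp: glue_def pre_points_def)
  from *(4) obtain z j where zj: "(V, z, j) \<in> tj_params" "(V, h) = tj_point V z j"
    by (metis pre_points_cases fst_conv fst_tj_point)
  have h: "h = snd (tj_point V z j)" using zj(2) by (metis snd_conv)
  have q: "q = tj_point U z (if Minus \<in> U \<and> Minus \<notin> V then - j else j)"
    using restrict_tj_point[OF zj(1) *(3)] *(6) h by simp
  have p: "p = tj_point V z j" using *(5) zj(2) by simp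
  from *(1-3) show ?thesis
  proof (cases rule: X_opens_subset_cases)
    case 1
    then show ?thesis using refl p q zj(1) by (simp add: tj_point_in_pre_points)
  next
    case 2
    then show ?thesis using plus[of z j] p q zj(1) by simp
  next
    case 3
    then show ?thesis using minus[of z j] p q zj(1) by simp
  qed
qed

lemma glue_tj_point:
  assumes "(Omega, z, j) \<in> tj_params"
  shows "(tj_point Omega z j, tj_point Omega_plus z j) \<in> glue"
    "(tj_point Omega z j, tj_point Omega_minus z (- j)) \<in> glue"
proof -
  have "(tj_point Omega z j, (U, F1_comp (fst (O_X U)) (snd (tj_point Omega z j)) (rho U Omega))) \<in> glue"
    if "U \<in> X_opens" "Omega \<subseteq> U" for U
    using tj_point_in_pre_points[OF assms] that
    unfolding glue_def by (auto simp: tj_point_def pre_points_def)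
  from this[of Omega_plus] this[of Omega_minus] show
    "(tj_point Omega z j, tj_point Omega_plus z j) \<in> glue"
    "(tj_point Omega z j, tj_point Omega_minus z (- j)) \<in> glue"
    by (simp_all add: restrict_tj_point[OF assms])
qed

text \<open>The sign from \<open>odd k\<close> turns \<open>inverse z\<close> into
  \<open>- inverse z\<close>. For z = 0 the parameter stays 0 while the charts are exchanged, so the
  origin and infinity are swapped.\<close>

lemma alpha_pre_tj_point:
  assumes "(U, z, j) \<in> tj_params"
  shows "alpha_pre (tj_point U z j)
    = tj_point (alpha_pt -` U) (- inverse z) (if U = Omega then - j else j)"
proof -
  have "tj_eval z j \<circ> alpha_mon (alpha_pt -` U) = tj_eval (- inverse z) (if U = Omega then - j else j)"
  proof
    fix x
    show "(tj_eval z j \<circ> alpha_mon (alpha_pt -` U)) x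
        = tj_eval (- inverse z) (if U = Omega then - j else j) x"
      by (cases x)
        (auto simp: alpha_pt_vimage_Omega power_int_minus_left power_int_minus power_int_inverse)
  qed
  then show ?thesis
    using alpha_pre_to_HR[OF mult_map_tj_eval[OF assms]] by (simp add: tj_point_def)
qed

lemma F1_comp_HR_map_to_HR:
  assumes "c 0 = 0"
  shows "F1_comp (spherical M) (HR_map c) (to_HR M f) = to_HR M (c \<circ> f)"
proof (intro ext)
  fix n a k
  show "F1_comp (spherical M) (HR_map c) (to_HR M f) n a k = to_HR M (c \<circ> f) n a k"
  proof (cases "a \<in> car (spherical M) n")
    case True
    \<comment> \<open>This bound places the value in \<open>car HR n\<close>, the domain to which
      \<open>HR_map c\<close> is restricted.\<close>
    then have "snd a \<le> n" by (auto elim!: spherical_carE simp: wedge_def)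
    then have "to_HR M f n a \<in> car HR n" using True by (auto simp: to_HR_def HR_def)
    with True assms show ?thesis by (simp add: F1_comp_def compose_def HR_map_def to_HR_def)
  qed (simp add: F1_comp_def compose_def to_HR_def)
qed

lemma cnj_power_int: "cnj (z powi k) = cnj z powi k"
  by (simp add: power_int_def)

lemma gal_pre_cnj_tj_point: "gal_pre cnj (tj_point U z j) = tj_point U (cnj z) (cnj j)"
proof -
  have "cnj \<circ> tj_eval z j = tj_eval (cnj z) (cnj j)"
  proof
    fix x show "(cnj \<circ> tj_eval z j) x = tj_eval (cnj z) (cnj j) x"
      by (cases x) (auto simp: cnj_power_int)
  qed
  then show ?thesis
    by (simp add: gal_pre_def tj_point_def O_X_def F1_comp_HR_map_to_HR)
qed

section \<open>Coordinates on the set of points\<close>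

text \<open>The value of J is normalised to its sign on \<open>Omega_plus\<close>, hence the minus
  sign on \<open>Omega_minus\<close>; this makes the coordinates invariant under gluing.\<close>

definition coord :: "'k::field pre_point \<Rightarrow> 'k P1 \<times> 'k" where
  "coord p = (let v = ev (O_mon (fst p)) (snd p) in
     if fst p = Omega_minus
     then (if v (tj_T (- 1)) = 0 then Infty else Fin (inverse (v (tj_T (- 1)))), - v tj_J)
     else (Fin (v (tj_T 1)), v tj_J))"

lemma ev_tj_point:
  "(U, z, j) \<in> tj_params \<Longrightarrow> x \<in> carrier (O_mon U) \<Longrightarrow>
    ev (O_mon U) (snd (tj_point U z j)) x = tj_eval z j x"
  by (simp add: tj_point_def ev_to_HR mult_map_tj_eval)

lemma coord_tj_point:
  assumes "(U, z, j) \<in> tj_params"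
  shows "coord (tj_point U z j) = (if U = Omega_minus then (if z = 0 then Infty else Fin z, - j) else (Fin z, j))"
proof -
  have "U \<in> X_opens" using assms by (simp add: tj_params_def)
  then show ?thesis
    by (cases rule: X_opens_cases)
      (use assms in \<open>auto simp: coord_def Let_def ev_tj_point power_int_minus\<close>)
qed

text \<open>Each gluing step preserves the coordinates in both directions, so the generated
  equivalence relation does too.\<close>

lemma X_rel_coord:
  assumes "(p, q) \<in> X_rel" "p \<in> pre_points"
  shows "q \<in> pre_points \<and> coord q = coord p"
proof -
  have glue: "p \<in> pre_points \<and> q \<in> pre_points \<and> coord p = coord q"
    if "(p, q) \<in> glue" for p q :: "'a pre_point"
    using that
  proof (cases rule: glue_cases)
    case (plus z j)
    then have "(Omega_plus, z, j) \<in> tj_params" by (auto simp: tj_params_def)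
    with plus show ?thesis by (auto simp: tj_point_in_pre_points coord_tj_point)
  next
    case (minus z j)
    then have "(Omega_minus, z, - j) \<in> tj_params" "z \<noteq> 0" by (auto simp: tj_params_def)
    with minus show ?thesis by (auto simp: tj_point_in_pre_points coord_tj_point)
  qed auto
  from assms(1) show ?thesis
    unfolding X_rel_def
  proof (induction rule: rtrancl_induct)
    case (step q r)
    then show ?case using glue[of q r] glue[of r q] by auto
  qed (simp add: assms(2))
qed

fun std_point :: "'k::field P1 \<times> 'k \<Rightarrow> 'k pre_point" where
  "std_point (Fin z, j) = tj_point Omega_plus z j"
| "std_point (Infty, j) = tj_point Omega_minus 0 (- j)"

lemma std_point:
  assumes "j * j = - 1"
  shows "std_point (P, j) \<in> pre_points" "coord (std_point (P, j)) = (P, j)"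
proof -
  have "(Omega_plus, z, j) \<in> tj_params" "(Omega_minus, z, - j) \<in> tj_params" for z
    using assms by (auto simp: tj_params_def)
  then show "std_point (P, j) \<in> pre_points" "coord (std_point (P, j)) = (P, j)"
    by (cases P; simp add: tj_point_in_pre_points coord_tj_point)+
qed

lemma sym_X_rel: "sym X_rel"
  unfolding X_rel_def by (intro sym_rtrancl sym_Un_converse)

text \<open>At most two gluing steps lead to the standard representative, so the coordinates are a
  complete invariant of a point.\<close>

lemma X_rel_std_point:
  assumes "p \<in> pre_points"
  shows "(p, std_point (coord p)) \<in> X_rel"
proof -
  have glue: "(p, q) \<in> glue \<Longrightarrow> (p, q) \<in> X_rel" for p q :: "'a pre_point"
    by (auto simp: X_rel_def)
  from assms obtain U z j where p: "(U, z, j) \<in> tj_params" "p = tj_point U z j"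
    by (rule pre_points_cases)
  then have "U \<in> X_opens" by (simp add: tj_params_def)
  then show ?thesis
  proof (cases rule: X_opens_cases)
    case 1
    then show ?thesis using p by (simp add: coord_tj_point X_rel_def)
  next
    case 2
    show ?thesis
    proof (cases "z = 0")
      case True
      then show ?thesis using 2 p by (simp add: coord_tj_point X_rel_def)
    next
      case False
      \<comment> \<open>Since z is nonzero, the point comes from \<open>Omega\<close> and can be
        moved to the other chart; restriction from \<open>Omega_minus\<close> negates
        \<open>- j\<close> back to \<open>j\<close>.\<close>
      then have \<Omega>: "(Omega, z, - j) \<in> tj_params" using p by (simp add: tj_params_def)
      have "(tj_point Omega_minus z j, tj_point Omega_plus z (- j)) \<in> X_rel"
        using glue[OF glue_tj_point(1)[OF \<Omega>]] symD[OF sym_X_rel glue[OF glue_tj_point(2)[OF \<Omega>]]]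
        by (simp add: X_rel_def)
      then show ?thesis using 2 p False by (simp add: coord_tj_point)
    qed
  next
    case 3
    then show ?thesis using p glue[OF glue_tj_point(1)] by (simp add: coord_tj_point)
  qed
qed

definition coord_fibre :: "'k::field P1 \<times> 'k \<Rightarrow> 'k pre_point set" where
  "coord_fibre x = {p \<in> pre_points. coord p = x}"

lemma X_class_eq_coord_fibre:
  assumes "p \<in> pre_points"
  shows "X_class p = coord_fibre (coord p)"
proof -
  have "(p, q) \<in> X_rel" if "q \<in> pre_points" "coord q = coord p" for q
  proof -
    have "(std_point (coord p), q) \<in> X_rel"
      using symD[OF sym_X_rel X_rel_std_point[OF that(1)]] that(2) by simp
    with X_rel_std_point[OF assms] show ?thesis unfolding X_rel_def by (rule rtrancl_trans)
  qed
  with X_rel_coord[OF _ assms] show ?thesis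
    by (auto simp: X_class_def coord_fibre_def)
qed

lemma snd_coord_square: "p \<in> pre_points \<Longrightarrow> snd (coord p) * snd (coord p) = - 1"
  by (elim pre_points_cases) (auto simp: coord_tj_point tj_params_def)

lemma X_points_eq: "X_points = {coord_fibre (P, j) | P j. j * j = - 1}"
proof -
  have "X_points = X_class ` pre_points"
    by (auto simp: X_points_def quotient_def X_class_def)
  also have "\<dots> = coord_fibre ` coord ` pre_points"
    unfolding image_image by (intro image_cong refl X_class_eq_coord_fibre)
  also have "coord ` pre_points = {(P, j :: 'a) | P j. j * j = - 1}"
  proof (intro equalityI subsetI)
    fix x :: "'a P1 \<times> 'a" assume "x \<in> coord ` pre_points"
    then have "snd x * snd x = - 1" using snd_coord_square by auto
    then show "x \<in> {(P, j) | P j. j * j = - 1}" by (cases x) simp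
  next
    fix x :: "'a P1 \<times> 'a" assume "x \<in> {(P, j) | P j. j * j = - 1}"
    then obtain P j where x: "x = (P, j)" "j * j = - 1" by blast
    show "x \<in> coord ` pre_points"
      using std_point[OF x(2), of P] unfolding x(1) by (intro image_eqI) (rule sym)
  qed
  also have "coord_fibre ` {(P, j :: 'a) | P j. j * j = - 1} = {coord_fibre (P, j) | P j. j * j = - 1}"
    by blast
  finally show ?thesis .
qed

text \<open>The hypothesis makes the left fibre nonempty, with \<open>std_point (P, j)\<close> as
  witness; fibres over other values of \<open>j\<close> are empty.\<close>

lemma coord_fibre_inject:
  assumes "j * j = - 1"
  shows "coord_fibre (P, j) = coord_fibre y \<longleftrightarrow> (P, j) = y"
proof
  assume eq: "coord_fibre (P, j) = coord_fibre y"
  have "std_point (P, j) \<in> coord_fibre (P, j)"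
    using std_point[OF assms, of P] by (simp add: coord_fibre_def)
  then have "std_point (P, j) \<in> coord_fibre y" by (simp only: eq)
  then show "(P, j) = y"
    using std_point[OF assms, of P] by (simp add: coord_fibre_def)
qed simp

section \<open>Involutions acting on fibres, and the orbits of \<alpha>\<close>

lemma image_coord_fibre:
  assumes "\<And>p. p \<in> pre_points \<Longrightarrow> g p \<in> pre_points"
    and "\<And>p. p \<in> pre_points \<Longrightarrow> g (g p) = p"
    and "\<And>p. p \<in> pre_points \<Longrightarrow> coord (g p) = G (coord p)"
    and "\<And>x. G (G x) = x"
  shows "g ` coord_fibre x = coord_fibre (G x)"
proof (intro equalityI subsetI)
  fix q assume "q \<in> coord_fibre (G x)"
  then have "g q \<in> coord_fibre x" "q = g (g q)" using assms by (auto simp: coord_fibre_def)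
  then show "q \<in> g ` coord_fibre x" by blast
qed (use assms in \<open>auto simp: coord_fibre_def\<close>)

fun neg_recip :: "'k::field P1 \<Rightarrow> 'k P1" where
  "neg_recip (Fin z) = (if z = 0 then Infty else Fin (- inverse z))"
| "neg_recip Infty = Fin 0"

lemma neg_recip_neg_recip [simp]: "neg_recip (neg_recip P) = P"
  by (cases P) auto

text \<open>The sign of \<open>j\<close> changes over every open set: over \<open>Omega\<close>
  through the action on J, over the charts because they are exchanged and \<open>coord\<close>
  negates J on \<open>Omega_minus\<close>.\<close>

lemma alpha_X_coord_fibre: "alpha_X (coord_fibre (P, j)) = coord_fibre (neg_recip P, - j)"
proof -
  have "coord (alpha_pre p) = map_prod neg_recip uminus (coord p)" if "p \<in> pre_points" for p :: "'a pre_point"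
    using that
  proof (rule pre_points_cases)
    fix U and z j :: 'a assume p: "(U, z, j) \<in> tj_params" "p = tj_point U z j"
    then have "U \<in> X_opens" by (simp add: tj_params_def)
    moreover from p have "(alpha_pt -` U, - inverse z, if U = Omega then - j else j) \<in> tj_params"
      by (auto simp: tj_params_def alpha_pt_vimage_Omega alpha_pt_vimage_X_opens)
    moreover from p have "z = 0 \<longrightarrow> U \<noteq> Omega" by (simp add: tj_params_def)
    ultimately show ?thesis
      using p by (elim X_opens_cases) (auto simp: alpha_pre_tj_point coord_tj_point)
  qed
  then have "alpha_pre ` coord_fibre (P, j) = coord_fibre (map_prod neg_recip uminus (P, j))"
    by (intro image_coord_fibre alpha_pre_in alpha_pre_involutive) (auto simp: map_prod_def split: prod.splits)
  then show ?thesis by (simp add: alpha_X_def)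
qed

lemma orbit_involution:
  assumes "f (f x) = x"
  shows "orbit f x = {x, f x}"
proof (intro equalityI subsetI)
  fix y assume "y \<in> orbit f x"
  then show "y \<in> {x, f x}" by induction (use assms in auto)
next
  \<comment> \<open>\<open>orbit f x\<close> starts at \<open>f x\<close>, so \<open>x\<close>
    itself enters only as \<open>f (f x)\<close>.\<close>
  have "f x \<in> orbit f x" "f (f x) \<in> orbit f x" by (blast intro: orbit.intros)+
  then show "y \<in> orbit f x" if "y \<in> {x, f x}" for y using assms that by auto
qed

lemma orbit_coord_fibre:
  "orbit alpha_X (coord_fibre (P, j)) = {coord_fibre (P, j), coord_fibre (neg_recip P, - j)}"
  by (subst orbit_involution) (simp_all add: alpha_X_coord_fibre)

section \<open>The canonical bijection\<close>

lemma F12_hom_cases: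
  assumes "h \<in> F12_hom (O_X U) HR12" "U \<in> X_opens"
  obtains z j where "(U, z, j) \<in> tj_params" "h = snd (tj_point U z j)"
  using assms pre_points_cases[of "(U, h)"]
  by (metis (no_types, lifting) SigmaI fst_conv fst_tj_point pre_points_def snd_conv)

text \<open>This resolves the definite description in \<open>canon\<close>: the two prescribed
  values are exactly the parameters, which gives existence and uniqueness.\<close>

lemma X_class_the_plus:
  assumes "j * j = - 1"
  shows "X_class (Omega_plus, THE h. h \<in> F12_hom (O_X Omega_plus) HR12 \<and>
      ev (O_mon Omega_plus) h (tj_T 1) = z \<and> ev (O_mon Omega_plus) h tj_J = j)
    = coord_fibre (Fin z, j)" (is "X_class (_, The ?h) = _")
proof -
  have zj: "(Omega_plus, z, j) \<in> tj_params" using assms by (simp add: tj_params_def)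
  have "The ?h = snd (tj_point Omega_plus z j)"
  proof (rule the_equality)
    show "?h (snd (tj_point Omega_plus z j))"
      using snd_tj_point_F12_hom[OF zj] by (simp add: ev_tj_point[OF zj] power_int_minus)
    fix h assume h: "?h h"
    then obtain z' j' where zj': "(Omega_plus, z', j') \<in> tj_params" "h = snd (tj_point Omega_plus z' j')"
      using F12_hom_cases[of h Omega_plus] by auto
    then show "h = snd (tj_point Omega_plus z j)" using h by (simp add: ev_tj_point)
  qed
  then have "(Omega_plus, The ?h) = tj_point Omega_plus z j" by (simp add: tj_point_def)
  then show ?thesis
    using X_class_eq_coord_fibre[OF tj_point_in_pre_points[OF zj]] by (simp add: coord_tj_point[OF zj])
qed

text \<open>The value \<open>- j\<close> of J on \<open>Omega_minus\<close> has normalised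
  coordinate \<open>j\<close>, so \<open>canon Infty\<close> lies over \<open>\<i>\<close> just as
  the finite points do.\<close>

lemma X_class_the_minus:
  assumes "j * j = - 1"
  shows "X_class (Omega_minus, THE h. h \<in> F12_hom (O_X Omega_minus) HR12 \<and>
      ev (O_mon Omega_minus) h (tj_T (- 1)) = 0 \<and> ev (O_mon Omega_minus) h tj_J = - j)
    = coord_fibre (Infty, j)" (is "X_class (_, The ?h) = _")
proof -
  have zj: "(Omega_minus, 0, - j) \<in> tj_params" using assms by (simp add: tj_params_def)
  have "The ?h = snd (tj_point Omega_minus 0 (- j))"
  proof (rule the_equality)
    show "?h (snd (tj_point Omega_minus 0 (- j)))"
      using snd_tj_point_F12_hom[OF zj] by (simp add: ev_tj_point[OF zj] power_int_minus)
    fix h assume h: "?h h"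
    then obtain z' j' where zj': "(Omega_minus, z', j') \<in> tj_params" "h = snd (tj_point Omega_minus z' j')"
      using F12_hom_cases[of h Omega_minus] by auto
    then show "h = snd (tj_point Omega_minus 0 (- j))" using h by (simp add: ev_tj_point power_int_minus)
  qed
  then have "(Omega_minus, The ?h) = tj_point Omega_minus 0 (- j)" by (simp add: tj_point_def)
  then show ?thesis
    using X_class_eq_coord_fibre[OF tj_point_in_pre_points[OF zj]] by (simp add: coord_tj_point[OF zj])
qed

lemma canon_eq: "canon P = {coord_fibre (P, \<i>), coord_fibre (neg_recip P, - \<i>)}"
  by (cases P) (simp_all only: canon.simps X_class_the_plus X_class_the_minus orbit_coord_fibre
    i_squared)

lemma bij_betw_canon: "bij_betw canon UNIV (C_infty :: complex pre_point set set set)"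
proof -
  have ii: "\<i> * \<i> = - 1" "- \<i> * - \<i> = - 1" by simp_all
  have "inj canon"
  proof (rule injI)
    fix P Q assume "canon P = canon Q"
    then have "coord_fibre (P, \<i>) \<in> {coord_fibre (Q, \<i>), coord_fibre (neg_recip Q, - \<i>)}"
      unfolding canon_eq by blast
    \<comment> \<open>The second alternative is impossible, since \<open>\<i>\<close> differs from
      \<open>- \<i>\<close>.\<close>
    then show "P = Q"
      by (auto simp: coord_fibre_inject[OF ii(1)] complex_eq_iff)
  qed
  moreover have "range canon = (C_infty :: complex pre_point set set set)"
  proof (intro equalityI subsetI)
    fix x assume "x \<in> range canon"
    then obtain P where x: "x = orbit alpha_X (coord_fibre (P, \<i>))"
      by (auto simp: canon_eq orbit_coord_fibre)
    have "coord_fibre (P, \<i>) \<in> X_points" using ii(1) unfolding X_points_eq by blast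
    then show "x \<in> C_infty" unfolding C_infty_def x by (rule imageI)
  next
    fix x :: "complex pre_point set set" assume "x \<in> C_infty"
    then obtain P j where "j * j = - 1" and x: "x = orbit alpha_X (coord_fibre (P, j))"
      by (auto simp: C_infty_def X_points_eq)
    then have "(j - \<i>) * (j + \<i>) = 0" by (simp add: algebra_simps)
    then consider "j = \<i>" | "j = - \<i>" by (auto simp: add_eq_0_iff2)
    then show "x \<in> range canon"
    proof cases
      case 1
      then have "x = canon P" by (simp add: x canon_eq orbit_coord_fibre)
      then show ?thesis by blast
    next
      case 2
      \<comment> \<open>The other member of the orbit has second coordinate
        \<open>\<i>\<close>.\<close>
      then have "x = canon (neg_recip P)" by (auto simp: x canon_eq orbit_coord_fibre)
      then show ?thesis by blast
    qed
  qed
  ultimately show ?thesis by (simp add: bij_betw_def)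
qed

section \<open>Complex conjugation and the antipodal map\<close>

lemma gal_X_cnj_coord_fibre: "gal_X cnj (coord_fibre (P, j)) = coord_fibre (map_P1 cnj P, cnj j)"
proof -
  have params: "(U, cnj z, cnj j) \<in> tj_params" if "(U, z, j) \<in> tj_params" for U z j
    using that by (auto simp: tj_params_def simp flip: complex_cnj_mult)
  have "gal_pre cnj ` coord_fibre (P, j) = coord_fibre (map_prod (map_P1 cnj) cnj (P, j))"
  proof (rule image_coord_fibre)
    fix p :: "complex pre_point" assume "p \<in> pre_points"
    then obtain U z j where p: "(U, z, j) \<in> tj_params" "p = tj_point U z j"
      by (rule pre_points_cases)
    show "gal_pre cnj p \<in> pre_points" "gal_pre cnj (gal_pre cnj p) = p"
      "coord (gal_pre cnj p) = map_prod (map_P1 cnj) cnj (coord p)"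
      using p(1) params[OF p(1)]
      by (simp_all add: p(2) gal_pre_cnj_tj_point tj_point_in_pre_points coord_tj_point)
  next
    fix x :: "complex P1 \<times> complex"
    show "map_prod (map_P1 cnj) cnj (map_prod (map_P1 cnj) cnj x) = x"
      by (cases x; cases "fst x") auto
  qed
  then show ?thesis by (simp add: gal_X_def)
qed

lemma antipode_eq: "antipode P = neg_recip (map_P1 cnj P)"
  by (cases P) (auto simp: divide_inverse)

text \<open>Conjugation exchanges \<open>\<i>\<close> and \<open>- \<i>\<close>, so the member of
  the image orbit over \<open>\<i>\<close> comes from the one over \<open>- \<i>\<close>, whose
  first coordinate is \<open>neg_recip P\<close>.\<close>

lemma gal_C_infty_canon: "gal_C_infty cnj (canon P) = canon (antipode P)"
proof -
  have "map_P1 cnj (neg_recip P) = antipode P" by (cases P) (auto simp: divide_inverse)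
  then show ?thesis
    by (auto simp: gal_C_infty_def canon_eq gal_X_cnj_coord_fibre antipode_eq)
qed

lemma antipode_antipode: "antipode (antipode P) = P"
  by (cases P) auto

text \<open>A nonzero finite fixed point would satisfy |z|^2 = -1, and 0 and infinity are
  exchanged.\<close>

lemma antipode_neq: "antipode P \<noteq> P"
proof (cases P)
  case (Fin z)
  have "- (1 / cnj z) \<noteq> z" if "z \<noteq> 0"
  proof
    assume "- (1 / cnj z) = z"
    then have "z * cnj z = - 1" using that by (simp add: field_simps)
    then have "complex_of_real ((cmod z)\<^sup>2) = complex_of_real (- 1)"
      by (simp only: complex_norm_square) simp
    then have "(cmod z)\<^sup>2 = - 1" unfolding of_real_eq_iff .
    then show False using zero_le_power2[of "cmod z"] by linarith
  qed
  then show ?thesis by (simp add: Fin)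
qed simp

theorem theorem1p2:
  shows "bij_betw canon UNIV (C_infty :: complex pre_point set set set) \<and>
    (\<forall>z. gal_C_infty cnj (canon z) = canon (antipode z)) \<and>
    (\<forall>z. antipode (antipode z) = z) \<and>
    (\<forall>z. antipode z \<noteq> z) \<and>
    antipode (Fin 0) = Infty \<and> antipode Infty = Fin 0"
  by (simp add: bij_betw_canon gal_C_infty_canon antipode_antipode antipode_neq)

end
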